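(* Let $n\ge 1$ be a fixed degree and $\omega\in(0,(n+1)\pi)$. Then $r\in\mathcal{U}_n$ is a unitary rational best approximation to $\mathrm{e}^{\mathrm{i}\omega x}$, i.e., $$\| r - \exp(\omega \cdot)\| = \min_{u \in\mathcal{U}_n} \| u - \exp(\omega \cdot)\| <2,$$ if and only if the phase error of $r(\mathrm{i} x)\approx \mathrm{e}^{\mathrm{i} \omega x}$ equioscillates between $2n+2$ points in $[-1,1]$. Moreover, in this case: (i) the unitary best approximation $r$ is unique; (ii) $r$ has minimal degree $n$ and distinct poles; (iii) there are exactly $2n+2$ equioscillation points, which include the points $-1$ and $1$; (iv) the $2n$ equioscillation points in $(-1,1)$ are exactly the zeros of the derivative of the phase error, and these zeros are simple.
   Context: For a complex polynomial $p$ let $p^\dag(z):=\overline{p}(-z)=\overline{p(-\overline z)}$, where $\overline p$ is the polynomial with complex-conjugated coefficients. Let $\mathcal{U}_n:=\{p^\dag/p : p \text{ a complex polynomial of degree}\le n,\ p\not\equiv 0\}$. Rational functions are identified with their irreducible form (common zeros of numerator and denominator, i.e. removable singularities, are cancelled); then every $r\in\mathcal{U}_n$ has no poles on $\mathrm{i}\mathbb{R}$ and satisfies $|r(\mathrm{i}x)|=1$ for all $x\in\mathbb{R}$. The minimal degree of $r$ is the smallest $m$ such that $r$ is a quotient of two polynomials of degree $\le m$. For a complex function $f$ let $\|f\|:=\max_{x\in[-1,1]}|f(\mathrm{i}x)|$; in particular $\|r-\exp(\omega\cdot)\|=\max_{x\in[-1,1]}|r(\mathrm{i}x)-\mathrm{e}^{\mathrm{i}\omega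 x}|$. Phase function and phase error. If $r\in\mathcal{U}_n$ has minimal degree $m$ and poles $s_j=\xi_j+\mathrm{i}\mu_j$, $j=1,\dots,m$ (then $\xi_j\ne0$), one can write $r(\mathrm{i}x)=\mathrm{e}^{\mathrm{i}g(x)}$ for $x\in\mathbb{R}$ with $$g(x)=\theta+2\sum_{j=1}^m\arctan\Big(\frac{x-\mu_j}{\xi_j}\Big),\qquad \theta\in\mathbb{R},$$ where $\theta$ is determined up to multiples of $2\pi$. If $\|r-\exp(\omega\cdot)\|<2$, there is exactly one $g$ of this form with $\max_{x\in[-1,1]}|g(x)-\omega x|<\pi$, and $g$ always denotes this one; if $\|r-\exp(\omega\cdot)\|=2$, $g$ may be any function of this form. The phase error is $g(x)-\omega x$. The phase error equioscillates between $m$ points $-1\le\eta_1<\dots<\eta_m\le1$ if $$g(\eta_j)-\omega\eta_j=(-1)^{j+\iota}\max_{x\in[-1,1]}|g(x)-\omega x|,\quad j=1,\dots,m,$$ for some $\iota\in\{0,1\}$; the points $\eta_j$ are called equioscillation points. *)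

theory Defs
  imports "HOL-Analysis.Analysis" "HOL-Computational_Algebra.Computational_Algebra"
    "HOL-Computational_Algebra.Field_as_Ring"
begin

text \<open>
  Rational functions are elements of the fraction field \<open>complex poly fract\<close>, so equality of
  rational functions is equality after cancelling common zeros.  \<open>quot_of_fract r\<close> is the
  irreducible form of \<open>r\<close>: a coprime pair of numerator and (monic) denominator.
\<close>

definition dag :: "complex poly \<Rightarrow> complex poly" where
  "dag p = pcompose (map_poly cnj p) [:0, -1:]"

definition unitary_rat :: "nat \<Rightarrow> complex poly fract set" where
  "unitary_rat n = {Fract (dag p) p | p. degree p \<le> n \<and> p \<noteq> 0}"

text \<open>Off the poles this is the value of the irreducible form; at a pole it is \<open>0\<close> (division by zero).\<close>

definition rat_eval :: "complex poly fract \<Rightarrow> complex \<Rightarrow> complex" where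
  "rat_eval r z = poly (fst (quot_of_fract r)) z / poly (snd (quot_of_fract r)) z"

definition min_degree :: "complex poly fract \<Rightarrow> nat" where
  "min_degree r =
     (LEAST m. \<exists>p q. q \<noteq> 0 \<and> degree p \<le> m \<and> degree q \<le> m \<and> r = Fract p q)"

text \<open>Poles are listed with multiplicity.\<close>

definition poles :: "complex poly fract \<Rightarrow> complex multiset" where
  "poles r = proots (snd (quot_of_fract r))"

text \<open>
  The maximum over \<open>[-1,1]\<close>, written as a supremum.  It is only applied to functions continuous
  on \<open>[-1,1]\<close> (elements of \<open>unitary_rat n\<close> have no poles on the imaginary axis), for which
  it is attained.
\<close>

definition max_norm :: "(real \<Rightarrow> 'a::real_normed_vector) \<Rightarrow> real" where
  "max_norm f = (SUP x\<in>{-1..1}. norm (f x))"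

definition approx_err :: "real \<Rightarrow> complex poly fract \<Rightarrow> real" where
  "approx_err \<omega> r =
     max_norm (\<lambda>x. rat_eval r (\<i> * of_real x) - exp (of_real \<omega> * (\<i> * of_real x)))"

definition best_approx :: "nat \<Rightarrow> real \<Rightarrow> complex poly fract \<Rightarrow> bool" where
  "best_approx n \<omega> r \<longleftrightarrow>
     r \<in> unitary_rat n \<and> (\<forall>u\<in>unitary_rat n. approx_err \<omega> r \<le> approx_err \<omega> u)"

definition phase_error :: "real \<Rightarrow> (real \<Rightarrow> real) \<Rightarrow> real \<Rightarrow> real" where
  "phase_error \<omega> g x = g x - \<omega> * x"

text \<open>
  \<open>g\<close> is an admissible phase function of \<open>r\<close>.  If the approximation error is below \<open>2\<close>, the
  last condition selects one of the functions differing by multiples of \<open>2\<pi>\<close>; if the error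
  equals \<open>2\<close>, all of them are admissible.
\<close>

definition phase_function :: "real \<Rightarrow> complex poly fract \<Rightarrow> (real \<Rightarrow> real) \<Rightarrow> bool" where
  "phase_function \<omega> r g \<longleftrightarrow>
     (\<exists>\<theta>. \<forall>x. g x = \<theta> + 2 * (\<Sum>s\<in>#poles r. arctan ((x - Im s) / Re s))) \<and>
     (\<forall>x. rat_eval r (\<i> * of_real x) = exp (\<i> * of_real (g x))) \<and>
     (approx_err \<omega> r < 2 \<longrightarrow> max_norm (phase_error \<omega> g) < pi)"

text \<open>Only the values of \<open>\<eta>\<close> on \<open>{1..m}\<close> matter.\<close>

definition equioscillates_at :: "(real \<Rightarrow> real) \<Rightarrow> nat \<Rightarrow> (nat \<Rightarrow> real) \<Rightarrow> bool" where
  "equioscillates_at e m \<eta> \<longleftrightarrow>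
     \<eta> ` {1..m} \<subseteq> {-1..1} \<and> strict_mono_on {1..m} \<eta> \<and>
     (\<exists>\<iota>\<in>{0, 1::nat}. \<forall>j\<in>{1..m}. e (\<eta> j) = (-1) ^ (j + \<iota>) * max_norm e)"

definition equioscillates :: "(real \<Rightarrow> real) \<Rightarrow> nat \<Rightarrow> bool" where
  "equioscillates e m \<longleftrightarrow> (\<exists>\<eta>. equioscillates_at e m \<eta>)"

text \<open>
  All points occurring in some alternation of \<open>e\<close>, of any length.  If this set has
  exactly \<open>m\<close> elements and \<open>e\<close> equioscillates between \<open>m\<close> points, then these \<open>m\<close> points are
  unique and no longer alternation exists.
\<close>

definition equioscillation_points :: "(real \<Rightarrow> real) \<Rightarrow> real set" where
  "equioscillation_points e = {x. \<exists>m \<eta>. equioscillates_at e m \<eta> \<and> x \<in> \<eta> ` {1..m}}"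

end

theory Submission
  imports Defs
begin

text \<open>
Write a rational function of the class as \<open>p\<^sup>\<dagger>/p\<close> and put \<open>p(ix) = a(x) + i b(x)\<close> with real
polynomials \<open>a\<close>, \<open>b\<close>. On the imaginary axis \<open>p\<^sup>\<dagger>\<close> is the complex conjugate of \<open>p\<close>, so cancelling
common zeros means dividing out \<open>gcd a b\<close>. Put \<open>w(x) = p(ix) e\<^sup>i\<^sup>\<omega>\<^sup>x\<^sup>/\<^sup>2 = C(x) + i S(x)\<close>. Then
\<open>r(ix) = e\<^sup>i\<^sup>\<omega>\<^sup>x cnj w / w\<close>, the error is below \<open>2\<close> exactly if \<open>C\<close> has no zero on \<open>[-1,1]\<close>, and
when \<open>C > 0\<close> the phase error is \<open>-2 arctan (S/C)\<close>. Minimising the error is thus minimising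
\<open>max \<bar>S/C\<bar>\<close> subject to \<open>C > 0\<close>, where \<open>C\<close> and \<open>S\<close> depend linearly on \<open>(a, b)\<close>: a generalised
rational approximation problem, for which the classical Chebyshev theory works.

Error below \<open>2\<close> (\<open>ex_positive_real_part\<close>): for \<open>\<omega> < (n+1)\<pi>\<close> one can choose \<open>C\<close> equal to
\<open>q sin(\<pi>t) + \<epsilon> q' cos(\<pi>t)\<close> with \<open>q(t) = (1-t)\<dots>(n-t)\<close> and \<open>t\<close> in a compact part of \<open>(0,n+1)\<close>.
There \<open>q sin(\<pi>t)\<close> is nonnegative and vanishes only at the integers, where \<open>q' cos(\<pi>t)\<close> is
positive.

Necessity (\<open>best_imp_alt_chain\<close>): changing \<open>(a, b)\<close> in the direction \<open>(u, v)\<close> changes \<open>S/C\<close> to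
first order by \<open>(a v - b u)/C\<^sup>2\<close>. If \<open>a\<close>, \<open>b\<close> are coprime with larger degree \<open>m\<close>, these
numerators are, by Bezout, all polynomials of degree at most \<open>n + m\<close>. Fewer than \<open>n + m + 2\<close>
alternation points of \<open>S/C\<close> would leave such a polynomial whose sign is opposite to that of
\<open>S/C\<close> at all extremal points, and \<open>r\<close> could be improved.

Counting (\<open>best_approx_structure\<close>): with \<open>k\<close> distinct poles the derivative of the phase error
has a numerator of degree at most \<open>2k\<close>, so that there are at most \<open>2k + 2 \<le> 2m + 2\<close> extremal
points. Together with \<open>n + m + 2 \<le> 2k + 2\<close> this forces \<open>k = m = n\<close> and equality throughout: \<open>2n\<close>
simple zeros of the derivative, all of them extremal, and both endpoints extremal.

Uniqueness (\<open>best_approx_unique\<close>): the constraints \<open>\<bar>S\<bar> \<le> K C\<close> are convex, so the sum of two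
optimal pairs is optimal; at its \<open>2n + 2\<close> extremal points both pairs have the same value of
\<open>S/C\<close>, and two elements of the class that agree at more than \<open>2n\<close> points are equal.

Sufficiency (\<open>equioscillation_imp_best\<close>): the phase error of a better approximant is everywhere
smaller than the equioscillating amplitude, so the difference of the two phases changes sign
\<open>2n + 1\<close> times, and again the two functions agree.
\<close>

section \<open>Unitary rational functions as pairs of real polynomials\<close>

text \<open>
The polynomial \<open>p\<close> with \<open>p(ix) = a(x) + i b(x)\<close> for real \<open>x\<close>; every complex polynomial has this
form.
\<close>

definition axis_poly :: "real poly \<Rightarrow> real poly \<Rightarrow> complex poly" where
  "axis_poly a b =
     pcompose (map_poly of_real a + smult \<i> (map_poly of_real b)) [:0, -\<i>:]"

lemma poly_of_real_map: "poly (map_poly of_real p) (of_real x :: complex) = of_real (poly p x)"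
  by (induction p) (auto simp: map_poly_pCons)

lemma poly_axis_poly:
  "poly (axis_poly a b) (\<i> * of_real x) = Complex (poly a x) (poly b x)"
proof -
  have *: "- (\<i> * (\<i> * complex_of_real x)) = of_real x"
    by (simp add: complex_eq_iff)
  have "poly (axis_poly a b) (\<i> * of_real x) = of_real (poly a x) + \<i> * of_real (poly b x)"
    unfolding axis_poly_def
    by (simp add: poly_pcompose * poly_of_real_map algebra_simps flip: mult.assoc)
  thus ?thesis by (simp add: complex_eq_iff)
qed

text \<open>
All identities between complex polynomials below are checked on the imaginary axis, where they
become identities between real and imaginary parts.
\<close>

lemma poly_eq_on_imaginary_axis:
  fixes p q :: "complex poly"
  assumes "\<And>x. poly p (\<i> * of_real x) = poly q (\<i> * of_real x)"
  shows "p = q"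
proof (rule ccontr)
  assume "p \<noteq> q"
  hence "finite {z. poly (p - q) z = 0}" by (intro poly_roots_finite) auto
  moreover have "(\<lambda>x::real. \<i> * of_real x) ` UNIV \<subseteq> {z. poly (p - q) z = 0}"
    using assms by auto
  ultimately have "finite ((\<lambda>x::real. \<i> * of_real x) ` (UNIV :: real set))"
    using finite_subset by blast
  moreover have "inj (\<lambda>x::real. \<i> * of_real x)"
    by (auto simp: inj_def)
  ultimately have "finite (UNIV :: real set)"
    by (metis finite_imageD)
  thus False using infinite_UNIV_char_0 by blast
qed

lemma axis_poly_mult_real:
  "axis_poly (d * a) (d * b) = axis_poly d 0 * axis_poly a b"
  by (rule poly_eq_on_imaginary_axis) (simp add: poly_axis_poly complex_eq_iff)

lemma poly_dag: "poly (dag p) z = cnj (poly p (- cnj z))"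
  by (simp add: dag_def poly_pcompose)

text \<open>
The reflection \<open>z \<mapsto> - cnj z\<close> fixes the imaginary axis, so there \<open>dag p\<close> is the conjugate of
\<open>p\<close>.
\<close>

lemma dag_axis_poly: "dag (axis_poly a b) = axis_poly a (- b)"
proof (rule poly_eq_on_imaginary_axis)
  fix x :: real
  have "- cnj (\<i> * complex_of_real x) = \<i> * of_real x" by simp
  thus "poly (dag (axis_poly a b)) (\<i> * of_real x) = poly (axis_poly a (- b)) (\<i> * of_real x)"
    by (simp only: poly_dag poly_axis_poly) (simp add: complex_eq_iff)
qed

lemma axis_poly_eq_0_iff [simp]: "axis_poly a b = 0 \<longleftrightarrow> a = 0 \<and> b = 0"
proof
  assume "axis_poly a b = 0"
  hence "Complex (poly a x) (poly b x) = 0" for x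
    by (metis poly_axis_poly poly_0)
  hence "poly a x = 0" "poly b x = 0" for x by (auto simp: complex_eq_iff)
  thus "a = 0 \<and> b = 0" using poly_all_0_iff_0 by blast
qed (simp add: axis_poly_def)

lemma degree_axis_poly: "degree (axis_poly a b) = max (degree a) (degree b)"
proof -
  let ?q = "map_poly of_real a + smult \<i> (map_poly of_real b) :: complex poly"
  have cf: "coeff ?q k = Complex (coeff a k) (coeff b k)" for k
    by (simp add: coeff_map_poly complex_eq_iff)
  have "degree ?q = max (degree a) (degree b)"
  proof (rule antisym)
    show "degree ?q \<le> max (degree a) (degree b)"
      by (rule degree_le) (simp add: cf coeff_eq_0 complex_eq_iff del: coeff_add coeff_smult)
    have "degree a \<le> degree ?q"
      by (rule degree_le) (metis cf coeff_eq_0 complex.sel(1) zero_complex.sel(1))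
    moreover have "degree b \<le> degree ?q"
      by (rule degree_le) (metis cf coeff_eq_0 complex.sel(2) zero_complex.sel(2))
    ultimately show "max (degree a) (degree b) \<le> degree ?q" by simp
  qed
  thus ?thesis by (simp add: axis_poly_def degree_pcompose)
qed

lemma Re_poly_of_real: "Re (poly q (of_real x)) = poly (map_poly Re q) x"
  by (induction q) (auto simp: map_poly_pCons)

lemma Im_poly_of_real: "Im (poly q (of_real x)) = poly (map_poly Im q) x"
  by (induction q) (auto simp: map_poly_pCons)

lemma ex_axis_poly: "\<exists>a b. p = axis_poly a b"
proof -
  let ?q = "pcompose p [:0, \<i>:]"
  have "p = axis_poly (map_poly Re ?q) (map_poly Im ?q)"
  proof (rule poly_eq_on_imaginary_axis)
    fix x :: real
    have "poly ?q (of_real x) = poly p (\<i> * of_real x)"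
      by (simp add: poly_pcompose algebra_simps)
    thus "poly p (\<i> * of_real x) = poly (axis_poly (map_poly Re ?q) (map_poly Im ?q)) (\<i> * of_real x)"
      unfolding poly_axis_poly Re_poly_of_real[symmetric] Im_poly_of_real[symmetric]
      by (simp add: complex_eq_iff)
  qed
  thus ?thesis by blast
qed

definition urat :: "real poly \<Rightarrow> real poly \<Rightarrow> complex poly fract" where
  "urat a b = Fract (axis_poly a (- b)) (axis_poly a b)"

text \<open>
A common real factor \<open>d\<close> of \<open>a\<close> and \<open>b\<close> contributes the same polynomial to numerator and
denominator.
\<close>

lemma urat_mult:
  assumes "d \<noteq> 0"
  shows "urat (d * a) (d * b) = urat a b"
proof (cases "axis_poly a b = 0")
  case False
  have "urat (d * a) (d * b) =
          Fract (axis_poly d 0 * axis_poly a (- b)) (axis_poly d 0 * axis_poly a b)"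
    unfolding urat_def axis_poly_mult_real[symmetric] by simp
  also have "\<dots> = urat a b"
    unfolding urat_def using False assms by (simp add: eq_fract)
  finally show ?thesis .
qed (simp add: urat_def)

lemma urat_uminus: "urat (- a) (- b) = urat a b"
  using urat_mult[of "-1" a b] by simp

lemma urat_in_unitary_rat:
  assumes "degree a \<le> n" "degree b \<le> n" "a \<noteq> 0 \<or> b \<noteq> 0"
  shows "urat a b \<in> unitary_rat n"
  unfolding unitary_rat_def urat_def mem_Collect_eq
  by (rule exI[of _ "axis_poly a b"]) (use assms in \<open>auto simp: dag_axis_poly degree_axis_poly\<close>)

lemma coprime_pair_nonzero:
  fixes a b :: "real poly"
  assumes "coprime a b"
  shows "a \<noteq> 0 \<or> b \<noteq> 0"
  using assms by auto

text \<open>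
Dividing by \<open>gcd a b\<close> produces the irreducible form inside the class of pairs.
\<close>

lemma ex_coprime_urat:
  assumes "a \<noteq> 0 \<or> b \<noteq> 0"
  shows "\<exists>a' b' d. d \<noteq> 0 \<and> a = d * a' \<and> b = d * b' \<and> coprime a' b' \<and> urat a b = urat a' b'"
proof -
  define d where "d = gcd a b"
  have "d \<noteq> 0" using assms by (simp add: d_def)
  moreover have "a = d * (a div d)" "b = d * (b div d)"
    by (simp_all add: d_def)
  moreover have "coprime (a div d) (b div d)"
    using assms unfolding d_def by (rule div_gcd_coprime)
  ultimately show ?thesis by (metis urat_mult)
qed

lemma unitary_rat_cases:
  assumes "r \<in> unitary_rat n"
  obtains a b where "r = urat a b" "coprime a b" "degree a \<le> n" "degree b \<le> n"
proof -
  obtain p where p: "r = Fract (dag p) p" "degree p \<le> n" "p \<noteq> 0"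
    using assms by (auto simp: unitary_rat_def)
  obtain a b where ab: "p = axis_poly a b" using ex_axis_poly by blast
  have nz: "a \<noteq> 0 \<or> b \<noteq> 0" using p(3) ab by auto
  obtain a' b' d where *: "d \<noteq> 0" "a = d * a'" "b = d * b'" "coprime a' b'" "urat a b = urat a' b'"
    using ex_coprime_urat[OF nz] by blast
  have "degree a \<le> n" "degree b \<le> n" using p(2) ab degree_axis_poly[of a b] by auto
  hence "degree a' \<le> n" "degree b' \<le> n"
    using * by (cases "a' = 0"; cases "b' = 0"; simp add: degree_mult_eq)+
  moreover have "r = urat a' b'" using p(1) ab *(5) by (simp add: urat_def dag_axis_poly)
  ultimately show ?thesis using that * by blast
qed

text \<open>
If \<open>u a + v b = 1\<close>, then \<open>Re ((u - iv)(a + ib)) = 1\<close>; adding the conjugate gives a Bezout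
identity for \<open>a + ib\<close> and \<open>a - ib\<close>.
\<close>

lemma coprime_axis_poly:
  assumes "coprime a b"
  shows "coprime (axis_poly a (- b)) (axis_poly a b)"
proof (rule coprimeI)
  fix d assume d: "d dvd axis_poly a (- b)" "d dvd axis_poly a b"
  obtain u v where uv: "u * a + v * b = 1"
    using assms bezout_coefficients_fst_snd[of a b] by (metis coprime_iff_gcd_eq_1)
  have uv': "poly u x * poly a x + poly v x * poly b x = 1" for x
    by (metis uv poly_1 poly_add poly_mult)
  have "axis_poly u (- v) * axis_poly a b + axis_poly u v * axis_poly a (- b) = [:2:]"
    by (rule poly_eq_on_imaginary_axis)
       (use uv' in \<open>auto simp: poly_axis_poly complex_eq_iff algebra_simps\<close>)
  hence "d dvd [:2:]" using d by (metis dvd_add dvd_mult)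
  moreover have "is_unit [:2 :: complex:]" by (simp add: is_unit_const_poly_iff dvd_field_iff)
  ultimately show "is_unit d" using dvd_trans by blast
qed

text \<open>
The cross difference \<open>a b' - b a'\<close> is the imaginary part of \<open>cnj p \<cdot> p'\<close>, so it vanishes where
the two quotients agree.
\<close>

lemma urat_eq_iff:
  assumes "coprime a b" "coprime a' b'"
  shows "urat a b = urat a' b' \<longleftrightarrow> a * b' = b * a'"
proof -
  have "urat a b = urat a' b' \<longleftrightarrow>
      axis_poly a (- b) * axis_poly a' b' = axis_poly a' (- b') * axis_poly a b"
    using coprime_pair_nonzero[OF assms(1)] coprime_pair_nonzero[OF assms(2)]
    by (simp add: urat_def eq_fract)
  also have "\<dots> \<longleftrightarrow> (\<forall>x. poly a x * poly b' x = poly b x * poly a' x)"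
  proof
    assume eq: "axis_poly a (- b) * axis_poly a' b' = axis_poly a' (- b') * axis_poly a b"
    show "\<forall>x. poly a x * poly b' x = poly b x * poly a' x"
    proof
      fix x
      have "poly (axis_poly a (- b)) (\<i> * of_real x) * poly (axis_poly a' b') (\<i> * of_real x) =
            poly (axis_poly a' (- b')) (\<i> * of_real x) * poly (axis_poly a b) (\<i> * of_real x)"
        by (metis eq poly_mult)
      thus "poly a x * poly b' x = poly b x * poly a' x"
        by (simp add: poly_axis_poly complex_eq_iff algebra_simps)
    qed
  next
    assume "\<forall>x. poly a x * poly b' x = poly b x * poly a' x"
    thus "axis_poly a (- b) * axis_poly a' b' = axis_poly a' (- b') * axis_poly a b"
      by (intro poly_eq_on_imaginary_axis) (simp add: poly_axis_poly complex_eq_iff algebra_simps)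
  qed
  also have "\<dots> \<longleftrightarrow> a * b' = b * a'"
    by (simp add: fun_eq_iff flip: poly_eq_poly_eq_iff)
  finally show ?thesis .
qed

text \<open>
Coprimality makes \<open>dag p / p\<close> the irreducible form up to normalising the denominator.
\<close>

lemma quot_of_fract_urat:
  assumes "coprime a b"
  obtains c where "c \<noteq> 0" "axis_poly a (- b) = smult c (fst (quot_of_fract (urat a b)))"
    "axis_poly a b = smult c (snd (quot_of_fract (urat a b)))"
proof -
  let ?p = "axis_poly a b" and ?q = "axis_poly a (- b)"
  have nz: "?p \<noteq> 0" using assms by (auto dest: coprime_pair_nonzero)
  have eq: "quot_of_fract (urat a b) = normalize_quot (?q, ?p)"
    
    using quot_of_fract_quot_to_fract[of "(?q, ?p)"] by (simp add: urat_def quot_to_fract_def)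
  obtain d where d: "?q = fst (normalize_quot (?q, ?p)) * d" "?p = snd (normalize_quot (?q, ?p)) * d"
      "d dvd ?q" "d dvd ?p"
    using normalize_quotE[OF nz] by blast
  have "is_unit d" using coprime_axis_poly[OF assms] d(3,4) coprime_common_divisor by blast
  then obtain c where "d = [:c:]" "c \<noteq> 0" by (metis is_unit_poly_iff not_is_unit_0)
  moreover have "q * [:c:] = smult c q" for q :: "complex poly" by simp
  ultimately show ?thesis
    using d(1,2) unfolding eq[symmetric] by (intro that[of c]) simp_all
qed

lemma poles_urat:
  assumes "coprime a b"
  shows "poles (urat a b) = proots (axis_poly a b)"
proof -
  obtain c where "c \<noteq> 0" "axis_poly a b = smult c (snd (quot_of_fract (urat a b)))"
    using quot_of_fract_urat[OF assms] by blast
  thus ?thesis by (simp add: poles_def)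
qed

lemma rat_eval_urat_coprime:
  assumes "coprime a b"
  shows "rat_eval (urat a b) z = poly (axis_poly a (- b)) z / poly (axis_poly a b) z"
proof -
  obtain c where c: "c \<noteq> 0" "axis_poly a (- b) = smult c (fst (quot_of_fract (urat a b)))"
    "axis_poly a b = smult c (snd (quot_of_fract (urat a b)))"
    using quot_of_fract_urat[OF assms] by blast
  show ?thesis unfolding c(2,3) rat_eval_def using c(1) by simp
qed

text \<open>
Stated for pairs that may have a common factor, since sums and perturbations of coprime pairs
can acquire one; the factor cancels where it does not vanish.
\<close>

lemma rat_eval_urat:
  assumes "poly a x \<noteq> 0 \<or> poly b x \<noteq> 0"
  shows "rat_eval (urat a b) (\<i> * of_real x) =
           cnj (Complex (poly a x) (poly b x)) / Complex (poly a x) (poly b x)"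
proof -
  have "a \<noteq> 0 \<or> b \<noteq> 0" using assms by auto
  then obtain a' b' d where *: "d \<noteq> 0" "a = d * a'" "b = d * b'" "coprime a' b'" "urat a b = urat a' b'"
    using ex_coprime_urat by blast
  have d: "poly d x \<noteq> 0" using assms * by auto
  have "Complex (poly a x) (poly b x) = of_real (poly d x) * Complex (poly a' x) (poly b' x)"
    by (simp add: * complex_eq_iff)
  moreover have "rat_eval (urat a b) (\<i> * of_real x) =
           cnj (Complex (poly a' x) (poly b' x)) / Complex (poly a' x) (poly b' x)"
    unfolding *(5) rat_eval_urat_coprime[OF *(4)] poly_axis_poly
    by (simp add: complex_cnj)
  ultimately show ?thesis using d by simp
qed

lemma coprime_no_common_root:
  fixes a b :: "real poly"
  assumes "coprime a b"
  shows "poly a x \<noteq> 0 \<or> poly b x \<noteq> 0"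
proof (rule ccontr)
  assume "\<not> ?thesis"
  hence "[:-x, 1:] dvd a" "[:-x, 1:] dvd b" by (auto simp: poly_eq_0_iff_dvd)
  hence "is_unit [:-x, 1:]" using assms coprime_common_divisor by blast
  thus False by (simp add: is_unit_poly_iff)
qed

lemma poles_urat_Re:
  assumes "coprime a b" "s \<in># poles (urat a b)"
  shows "Re s \<noteq> 0"
proof
  assume "Re s = 0"
  hence s: "s = \<i> * of_real (Im s)" by (simp add: complex_eq_iff)
  have "axis_poly a b \<noteq> 0" using assms(1) by (auto dest: coprime_pair_nonzero)
  hence "poly (axis_poly a b) s = 0" using assms by (simp add: poles_urat)
  hence "Complex (poly a (Im s)) (poly b (Im s)) = 0" using s poly_axis_poly by metis
  thus False using coprime_no_common_root[OF assms(1), of "Im s"] by (simp add: complex_eq_iff)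
qed

lemma size_poles_urat:
  assumes "coprime a b"
  shows "size (poles (urat a b)) = max (degree a) (degree b)"
  by (simp add: poles_urat[OF assms] size_proots_complex degree_axis_poly)

text \<open>
In any other representation the irreducible denominator divides the denominator.
\<close>

lemma min_degree_urat:
  assumes "coprime a b"
  shows "min_degree (urat a b) = max (degree a) (degree b)"
  unfolding min_degree_def
proof (rule Least_equality)
  let ?p = "axis_poly a b" and ?q = "axis_poly a (- b)"
  have nz: "?p \<noteq> 0" using assms by (auto dest: coprime_pair_nonzero)
  show "\<exists>p q. q \<noteq> 0 \<and> degree p \<le> max (degree a) (degree b) \<and>
      degree q \<le> max (degree a) (degree b) \<and> urat a b = Fract p q"
    by (rule exI[of _ ?q], rule exI[of _ ?p]) (use nz in \<open>auto simp: degree_axis_poly urat_def\<close>)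
  fix m assume "\<exists>p q. q \<noteq> 0 \<and> degree p \<le> m \<and> degree q \<le> m \<and> urat a b = Fract p q"
  then obtain p q where pq: "q \<noteq> 0" "degree q \<le> m" "urat a b = Fract p q" by blast
  hence "?q * q = p * ?p" using nz by (simp add: urat_def eq_fract)
  hence "?p dvd ?q * q" by simp
  hence "?p dvd q"
    using coprime_axis_poly[OF assms] by (simp add: coprime_commute coprime_dvd_mult_right_iff)
  thus "max (degree a) (degree b) \<le> m"
    using pq dvd_imp_degree_le degree_axis_poly by (metis order_trans)
qed

section \<open>The error in rotated coordinates\<close>

lemma max_norm_attained:
  fixes f :: "real \<Rightarrow> 'a::real_normed_vector"
  assumes "continuous_on {-1..1} f"
  obtains x where "x \<in> {-1..1}" "norm (f x) = max_norm f" "\<And>y. y \<in> {-1..1} \<Longrightarrow> norm (f y) \<le> max_norm f"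
proof -
  have "continuous_on {-1..1} (\<lambda>x. norm (f x))" using assms by (intro continuous_intros)
  then obtain x where x: "x \<in> {-1..1}" "\<And>y. y \<in> {-1..1} \<Longrightarrow> norm (f y) \<le> norm (f x)"
    using continuous_attains_sup[of "{-1..1::real}" "\<lambda>x. norm (f x)"] by auto
  have "max_norm f = norm (f x)"
    unfolding max_norm_def using x by (intro cSup_eq_maximum) auto
  thus ?thesis using that[of x] x by simp
qed

lemma norm_le_max_norm:
  fixes f :: "real \<Rightarrow> 'a::real_normed_vector"
  assumes "continuous_on {-1..1} f" "x \<in> {-1..1}"
  shows "norm (f x) \<le> max_norm f"
  using max_norm_attained[OF assms(1)] assms(2) by metis

lemma max_norm_less_iff:
  fixes f :: "real \<Rightarrow> 'a::real_normed_vector"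
  assumes "continuous_on {-1..1} f"
  shows "max_norm f < c \<longleftrightarrow> (\<forall>x\<in>{-1..1}. norm (f x) < c)"
proof -
  obtain x where "x \<in> {-1..1}" "norm (f x) = max_norm f" "\<And>y. y \<in> {-1..1} \<Longrightarrow> norm (f y) \<le> max_norm f"
    using max_norm_attained[OF assms] by blast
  thus ?thesis by (metis order_le_less_trans)
qed

lemma max_norm_nonneg:
  fixes f :: "real \<Rightarrow> 'a::real_normed_vector"
  assumes "continuous_on {-1..1} f"
  shows "max_norm f \<ge> 0"
  using norm_le_max_norm[OF assms, of 0] by (auto intro: order_trans[OF norm_ge_zero])

lemma nonzero_imp_constant_sign:
  fixes f :: "real \<Rightarrow> real"
  assumes "continuous_on {-1..1} f" "\<And>x. x \<in> {-1..1} \<Longrightarrow> f x \<noteq> 0"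
  shows "(\<forall>x\<in>{-1..1}. f x > 0) \<or> (\<forall>x\<in>{-1..1}. f x < 0)"
proof (rule ccontr)
  assume "\<not> ?thesis"
  then obtain x y where xy: "x \<in> {-1..1}" "f x \<le> 0" "y \<in> {-1..1}" "f y \<ge> 0"
    by (auto simp: not_less)
  have "connected (f ` {-1..1})"
    using assms(1) by (intro connected_continuous_image) auto
  from connectedD_interval[OF this, of "f x" "f y" 0] xy have "0 \<in> f ` {-1..1}" by blast
  thus False using assms(2) by auto
qed

text \<open>
\<open>rot_re\<close> and \<open>rot_im\<close> are real and imaginary part of \<open>w(x) = (a(x) + i b(x)) e\<^sup>i\<^sup>\<omega>\<^sup>x\<^sup>/\<^sup>2\<close>.
Multiplying by this factor turns approximation of \<open>e\<^sup>i\<^sup>\<omega>\<^sup>x\<close> by \<open>cnj p / p\<close> into approximation of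
\<open>1\<close> by \<open>cnj w / w\<close>.
\<close>

definition rot_re :: "real \<Rightarrow> real poly \<Rightarrow> real poly \<Rightarrow> real \<Rightarrow> real" where
  "rot_re \<omega> a b x = poly a x * cos (\<omega> * x / 2) - poly b x * sin (\<omega> * x / 2)"

definition rot_im :: "real \<Rightarrow> real poly \<Rightarrow> real poly \<Rightarrow> real \<Rightarrow> real" where
  "rot_im \<omega> a b x = poly a x * sin (\<omega> * x / 2) + poly b x * cos (\<omega> * x / 2)"

lemma Complex_rot:
  "Complex (rot_re \<omega> a b x) (rot_im \<omega> a b x) = Complex (poly a x) (poly b x) * cis (\<omega> * x / 2)"
  by (simp add: complex_eq_iff rot_re_def rot_im_def)

lemma continuous_rot [continuous_intros]:
  "continuous_on S (rot_re \<omega> a b)" "continuous_on S (rot_im \<omega> a b)"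
  unfolding rot_re_def rot_im_def by (intro continuous_intros; simp)+

lemma rot_add:
  "rot_re \<omega> (a + u) (b + v) x = rot_re \<omega> a b x + rot_re \<omega> u v x"
  "rot_im \<omega> (a + u) (b + v) x = rot_im \<omega> a b x + rot_im \<omega> u v x"
  by (simp_all add: rot_re_def rot_im_def algebra_simps)

lemma rot_smult:
  "rot_re \<omega> (smult t u) (smult t v) x = t * rot_re \<omega> u v x"
  "rot_im \<omega> (smult t u) (smult t v) x = t * rot_im \<omega> u v x"
  by (simp_all add: rot_re_def rot_im_def algebra_simps)

lemma rot_re_uminus: "rot_re \<omega> (- a) (- b) x = - rot_re \<omega> a b x"
  by (simp add: rot_re_def)

text \<open>
The imaginary part of \<open>cnj w \<cdot> w'\<close> does not see the common rotation, hence is a polynomial.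
\<close>

lemma rot_cross:
  "rot_re \<omega> a b x * rot_im \<omega> u v x - rot_im \<omega> a b x * rot_re \<omega> u v x = poly (a * v - b * u) x"
proof -
  have "rot_re \<omega> a b x * rot_im \<omega> u v x - rot_im \<omega> a b x * rot_re \<omega> u v x =
    (poly a x * poly v x - poly b x * poly u x) * ((cos (\<omega> * x / 2))\<^sup>2 + (sin (\<omega> * x / 2))\<^sup>2)"
    unfolding rot_re_def rot_im_def by algebra
  thus ?thesis by simp
qed

lemma rat_eval_rot:
  assumes "w = Complex (rot_re \<omega> a b x) (rot_im \<omega> a b x)" "w \<noteq> 0"
  shows "rat_eval (urat a b) (\<i> * of_real x) = cis (\<omega> * x) * (cnj w / w)"
proof -
  let ?p = "Complex (poly a x) (poly b x)"
  have w: "w = ?p * cis (\<omega> * x / 2)" unfolding assms(1) Complex_rot ..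
  have "?p \<noteq> 0" using assms(2) w by auto
  hence r: "rat_eval (urat a b) (\<i> * of_real x) = cnj ?p / ?p"
    by (intro rat_eval_urat) (auto simp: complex_eq_iff)
  have "cnj w / w = cnj ?p / ?p * (cis (- (\<omega> * x / 2)) / cis (\<omega> * x / 2))"
    unfolding w by (simp add: cis_cnj)
  also have "cis (- (\<omega> * x / 2)) / cis (\<omega> * x / 2) = cis (- (\<omega> * x))"
    by (simp add: cis_divide)
  finally show ?thesis unfolding r by (simp add: cis_mult flip: mult.assoc)
qed

text \<open>
\<open>w\<close> stays in the open right half-plane. For coprime \<open>a\<close>, \<open>b\<close> this expresses, up to a common
change of sign, that the error is below \<open>2\<close>.
\<close>

definition half_plane :: "real \<Rightarrow> real poly \<Rightarrow> real poly \<Rightarrow> bool" where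
  "half_plane \<omega> a b \<longleftrightarrow> (\<forall>x\<in>{-1..1}. rot_re \<omega> a b x > 0)"

text \<open>
The tangent of minus half the phase error.
\<close>

definition tan_err :: "real \<Rightarrow> real poly \<Rightarrow> real poly \<Rightarrow> real \<Rightarrow> real" where
  "tan_err \<omega> a b x = rot_im \<omega> a b x / rot_re \<omega> a b x"

lemma half_planeD: "half_plane \<omega> a b \<Longrightarrow> x \<in> {-1..1} \<Longrightarrow> rot_re \<omega> a b x > 0"
  by (simp add: half_plane_def)

lemma half_plane_nonzero: "half_plane \<omega> a b \<Longrightarrow> a \<noteq> 0 \<or> b \<noteq> 0"
  using half_planeD[of \<omega> a b 0] by (auto simp: rot_re_def)

lemma continuous_on_tan_err: "half_plane \<omega> a b \<Longrightarrow> continuous_on {-1..1} (tan_err \<omega> a b)"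
  unfolding tan_err_def by (intro continuous_intros) (auto dest: half_planeD)

lemma cis_arctan: "cis (arctan t) = Complex 1 t / of_real (sqrt (1 + t\<^sup>2))"
  by (simp add: complex_eq_iff cos_arctan sin_arctan)

lemma cis_double_arctan: "cis (2 * arctan t) = Complex 1 t / Complex 1 (- t)"
proof -
  have "cis (2 * arctan t) = cis (arctan t) / cis (arctan (- t))"
    by (simp add: cis_divide arctan_minus)
  also have "\<dots> = Complex 1 t / Complex 1 (- t)"
  proof -
    have "sqrt (1 + t\<^sup>2) \<noteq> 0" by (simp add: add_nonneg_eq_0_iff)
    thus ?thesis unfolding cis_arctan by (simp del: real_sqrt_eq_zero_cancel_iff)
  qed
  finally show ?thesis .
qed

lemma rat_eval_half_plane:
  assumes "half_plane \<omega> a b" "x \<in> {-1..1}"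
  shows "rat_eval (urat a b) (\<i> * of_real x) = cis (\<omega> * x - 2 * arctan (tan_err \<omega> a b x))"
proof -
  let ?C = "rot_re \<omega> a b x" and ?S = "rot_im \<omega> a b x" and ?t = "tan_err \<omega> a b x"
  have C: "?C > 0" using assms by (rule half_planeD)
  have w: "Complex ?C ?S = of_real ?C * Complex 1 ?t" "cnj (Complex ?C ?S) = of_real ?C * Complex 1 (- ?t)"
    using C by (simp_all add: complex_eq_iff tan_err_def complex_cnj)
  have "Complex ?C ?S \<noteq> 0" using C by (simp add: complex_eq_iff)
  hence "rat_eval (urat a b) (\<i> * of_real x) = cis (\<omega> * x) * (cnj (Complex ?C ?S) / Complex ?C ?S)"
    by (rule rat_eval_rot[OF refl])
  also have "cnj (Complex ?C ?S) / Complex ?C ?S = cis (2 * arctan (- ?t))"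
    unfolding w(2) unfolding w(1) cis_double_arctan minus_minus using C by simp
  finally show ?thesis by (simp add: cis_mult arctan_minus)
qed

lemma exp_times_ii: "exp (of_real \<omega> * (\<i> * of_real x)) = cis (\<omega> * x)"
  by (simp add: cis_conv_exp mult.left_commute)

lemma norm_cis_diff: "norm (cis s - cis t) = 2 * \<bar>sin ((s - t) / 2)\<bar>"
proof -
  have "cis s - cis t = cis t * (cis (s - t) - 1)" by (simp add: algebra_simps cis_mult)
  thus ?thesis using dist_exp_i_1[of "s - t"] by (simp add: norm_mult cis_conv_exp)
qed

lemma continuous_on_rat_eval:
  assumes "r \<in> unitary_rat n"
  shows "continuous_on S (\<lambda>x. rat_eval r (\<i> * of_real x))"
proof -
  obtain a b where r: "r = urat a b" "coprime a b" using assms by (rule unitary_rat_cases)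
  have "rat_eval r (\<i> * of_real x) = (of_real (poly a x) -
      \<i> * of_real (poly b x)) / (of_real (poly a x) + \<i> * of_real (poly b x))" for x
    unfolding r(1) using rat_eval_urat[OF coprime_no_common_root[OF r(2)], of x]
    by (simp add: Complex_eq)
  moreover have "of_real (poly a x) + \<i> * of_real (poly b x) \<noteq> (0 :: complex)" for x
    using coprime_no_common_root[OF r(2), of x] by (auto simp: complex_eq_iff)
  ultimately show ?thesis by (simp only:) (intro continuous_intros; simp)
qed

lemma continuous_on_err:
  assumes "r \<in> unitary_rat n"
  shows "continuous_on S (\<lambda>x. rat_eval r (\<i> * of_real x) - exp (of_real \<omega> * (\<i> * of_real x)))"
  by (intro continuous_intros continuous_on_rat_eval[OF assms])

lemma norm_rat_eval:
  assumes "r \<in> unitary_rat n"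
  shows "norm (rat_eval r (\<i> * of_real x)) = 1"
proof -
  obtain a b where r: "r = urat a b" "coprime a b" using assms by (rule unitary_rat_cases)
  have "Complex (poly a x) (poly b x) \<noteq> 0"
    using coprime_no_common_root[OF r(2), of x] by (auto simp: complex_eq_iff)
  thus ?thesis unfolding r(1) rat_eval_urat[OF coprime_no_common_root[OF r(2)]]
    by (simp add: norm_divide)
qed

lemma approx_err_le_2:
  assumes "r \<in> unitary_rat n"
  shows "approx_err \<omega> r \<le> 2"
proof -
  obtain x where "norm (rat_eval r (\<i> * of_real x) - exp (of_real \<omega> * (\<i> * of_real x))) = approx_err \<omega> r"
    unfolding approx_err_def using max_norm_attained[OF continuous_on_err[OF assms]] by blast
  moreover have "norm (rat_eval r (\<i> * of_real x) - exp (of_real \<omega> * (\<i> * of_real x))) \<le> 1 + 1"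
    by (rule norm_triangle_le_diff) (simp add: norm_rat_eval[OF assms] exp_times_ii)
  ultimately show ?thesis by simp
qed

text \<open>
The pointwise error is the increasing function \<open>2 sin (arctan \<bar>t\<bar>)\<close> of \<open>t = S/C\<close>, so both
maxima are attained at the same point.
\<close>

lemma approx_err_half_plane:
  assumes "half_plane \<omega> a b"
  shows "approx_err \<omega> (urat a b) = 2 * sin (arctan (max_norm (tan_err \<omega> a b)))"
proof -
  let ?E = "tan_err \<omega> a b"
  have err: "norm (rat_eval (urat a b) (\<i> * of_real x) - exp (of_real \<omega> * (\<i> * of_real x))) =
      2 * sin (arctan \<bar>?E x\<bar>)" if "x \<in> {-1..1}" for x
  proof -
    have "\<bar>sin (arctan (?E x))\<bar> = sin (arctan \<bar>?E x\<bar>)"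
      by (simp add: sin_arctan abs_divide)
    thus ?thesis
      by (simp add: rat_eval_half_plane[OF assms that] exp_times_ii norm_cis_diff)
  qed
  have mono: "sin (arctan s) \<le> sin (arctan t)" if "s \<le> t" for s t
    using that arctan_bounded[of s] arctan_bounded[of t]
        by (subst sin_mono_le_eq) (auto intro: arctan_monotone')
  obtain x where "x \<in> {-1..1}" "\<bar>?E x\<bar> = max_norm ?E" "\<And>y. y \<in> {-1..1} \<Longrightarrow> \<bar>?E y\<bar> \<le> max_norm ?E"
    using max_norm_attained[OF continuous_on_tan_err[OF assms]] by auto
  thus ?thesis
    unfolding approx_err_def max_norm_def[of
        "\<lambda>x. rat_eval (urat a b) (\<i> * complex_of_real x) -
            exp (complex_of_real \<omega> * (\<i> * complex_of_real x))"]
    by (intro cSup_eq_maximum) (auto simp: err intro!: mono image_eqI[of _ _ x])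
qed

lemma approx_err_half_plane_less_2: "half_plane \<omega> a b \<Longrightarrow> approx_err \<omega> (urat a b) < 2"
  using sin_monotone_2pi[of "arctan (max_norm (tan_err \<omega> a b))" "pi / 2"]
    arctan_bounded[of "max_norm (tan_err \<omega> a b)"]
  by (simp add: approx_err_half_plane)

lemma approx_err_le_iff:
  assumes "half_plane \<omega> a b" "half_plane \<omega> a' b'" 
  shows "approx_err \<omega> (urat a b) \<le> approx_err \<omega> (urat a' b') \<longleftrightarrow>
    max_norm (tan_err \<omega> a b) \<le> max_norm (tan_err \<omega> a' b')"
  unfolding approx_err_half_plane[OF assms(1)] approx_err_half_plane[OF assms(2)]
  using arctan_bounded[of "max_norm (tan_err \<omega> a b)"] arctan_bounded[of "max_norm (tan_err \<omega> a' b')"]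
  by (simp add: sin_mono_le_eq arctan_le_iff)

text \<open>
Where \<open>C\<close> vanishes, \<open>cnj w / w = -1\<close> and the error is \<open>2\<close>. Hence \<open>C\<close> has constant sign, and
replacing \<open>(a, b)\<close> by \<open>(-a, -b)\<close> does not change the quotient.
\<close>

lemma ex_half_plane_rep:
  assumes "r \<in> unitary_rat n" "approx_err \<omega> r < 2"
  obtains a b where "r = urat a b" "coprime a b" "degree a \<le> n" "degree b \<le> n" "half_plane \<omega> a b"
proof -
  obtain a b where r: "r = urat a b" "coprime a b" "degree a \<le> n" "degree b \<le> n"
    using assms(1) by (rule unitary_rat_cases)
  have nz: "rot_re \<omega> a b x \<noteq> 0" if x: "x \<in> {-1..1}" for x
  proof
    assume 0: "rot_re \<omega> a b x = 0"
    let ?w = "Complex (rot_re \<omega> a b x) (rot_im \<omega> a b x)"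
    have "?w \<noteq> 0" unfolding Complex_rot
      using coprime_no_common_root[OF r(2), of x] by (auto simp: complex_eq_iff[of "Complex _ _"])
    moreover from this have "cnj ?w / ?w = -1" using 0
      by (simp add: complex_cnj divide_eq_eq) (simp add: complex_eq_iff)
    ultimately have "rat_eval r (\<i> * of_real x) = - cis (\<omega> * x)"
      using rat_eval_rot[OF refl, of \<omega> a b x] r(1) by simp
    hence "norm (rat_eval r (\<i> * of_real x) - exp (of_real \<omega> * (\<i> * of_real x))) =
        norm (- (2 * cis (\<omega> * x)))"
      unfolding exp_times_ii by simp
    also have "\<dots> = 2" by (simp add: norm_mult)
    finally show False
      using norm_le_max_norm[OF continuous_on_err[OF assms(1)] x, of \<omega>] assms(2)
      unfolding approx_err_def by linarith
  qed
  have "(\<forall>x\<in>{-1..1}. rot_re \<omega> a b x > 0) \<or> (\<forall>x\<in>{-1..1}. rot_re \<omega> a b x < 0)"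
    by (rule nonzero_imp_constant_sign[OF continuous_rot(1) nz])
  thus ?thesis
  proof
    assume "\<forall>x\<in>{-1..1}. rot_re \<omega> a b x > 0"
    thus ?thesis using that r by (simp add: half_plane_def)
  next
    assume "\<forall>x\<in>{-1..1}. rot_re \<omega> a b x < 0"
    hence "half_plane \<omega> (- a) (- b)" by (simp add: half_plane_def rot_re_uminus)
    thus ?thesis using that[of "- a" "- b"] r by (simp add: urat_uminus)
  qed
qed

section \<open>Approximants with error below two\<close>

text \<open>
Serves both for the approximant constructed in this section and for improving a function with
too few alternation points. On the compact set where \<open>G \<le> 0\<close> the function \<open>F\<close> has a positive
minimum, which dominates \<open>\<epsilon> G\<close> for small \<open>\<epsilon>\<close>.
\<close>

lemma positive_perturbation:
  fixes F G :: "real \<Rightarrow> real"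
  assumes S: "compact S" and F: "continuous_on S F" and G: "continuous_on S G"
    and pos: "\<And>t. t \<in> S \<Longrightarrow> F t \<ge> 0" "\<And>t. t \<in> S \<Longrightarrow> F t = 0 \<Longrightarrow> G t > 0"
  shows "\<exists>\<epsilon>0>0. \<forall>\<epsilon>. 0 < \<epsilon> \<and> \<epsilon> \<le> \<epsilon>0 \<longrightarrow> (\<forall>t\<in>S. F t + \<epsilon> * G t > 0)"
proof -
  let ?Z = "S \<inter> G -` {..0}"
  have Z: "compact ?Z"
    using compact_Int_closed[OF S continuous_closed_preimage[OF G compact_imp_closed[OF S] closed_atMost]]
    by (simp add: Int_left_absorb)
  show ?thesis
  proof (cases "?Z = {}")
    case True
    hence "F t + \<epsilon> * G t > 0" if "0 < \<epsilon>" "t \<in> S" for \<epsilon> t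
      using pos[OF that(2)] that by (smt (verit, best) Int_iff atMost_iff empty_iff mult_pos_pos vimage_eq)
    thus ?thesis by (intro exI[of _ 1]) auto
  next
    case False
    obtain z where z: "z \<in> ?Z" "\<And>t. t \<in> ?Z \<Longrightarrow> F z \<le> F t"
      using continuous_attains_inf[OF Z False continuous_on_subset[OF F]] by blast
    have c: "F z > 0" using pos[of z] z(1) by force
    obtain M where M: "\<And>t. t \<in> S \<Longrightarrow> \<bar>G t\<bar> \<le> M"
      using compact_imp_bounded[OF compact_continuous_image[OF G S]]
      by (auto simp: bounded_iff)
    have M0: "M \<ge> 0" using M z(1) abs_ge_zero order_trans by blast
    define \<epsilon>0 where "\<epsilon>0 = F z / (M + 1)"
    have "\<epsilon>0 > 0" using c M0 by (simp add: \<epsilon>0_def)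
    moreover have "F t + \<epsilon> * G t > 0" if \<epsilon>: "0 < \<epsilon>" "\<epsilon> \<le> \<epsilon>0" and t: "t \<in> S" for \<epsilon> t
    proof (cases "G t > 0")
      case True
      thus ?thesis using pos(1)[OF t] \<epsilon> by (simp add: add_nonneg_pos)
    next
      case False
      have "\<epsilon> * \<bar>G t\<bar> \<le> \<epsilon>0 * M"
        using \<epsilon> M[OF t] M0 by (intro mult_mono) auto
      also have "\<dots> < F z"
        using c M0 by (simp add: \<epsilon>0_def field_simps)
      also have "F z \<le> F t"
        using z(2) t False by simp
      finally show ?thesis using False by simp
    qed
    ultimately show ?thesis by blast
  qed
qed

text \<open>
The polynomial \<open>(1 - t)(2 - t)\<dots>(n - t)\<close>, in a recursive form that shifts the roots.
\<close>

primrec root_product :: "nat \<Rightarrow> real poly" where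
  "root_product 0 = 1"
| "root_product (Suc n) = [:1, -1:] * pcompose (root_product n) [:-1, 1:]"

lemma degree_root_product: "degree (root_product n) \<le> n"
proof (induction n)
  case (Suc n)
  have "degree (root_product (Suc n)) \<le> degree [:1, -1 :: real:] +
      degree (pcompose (root_product n) [:-1, 1:])"
    unfolding root_product.simps by (rule degree_mult_le)
  also have "\<dots> \<le> Suc n" using Suc by (simp add: degree_pcompose)
  finally show ?case .
qed simp

lemma root_product_pos: "t < 1 \<Longrightarrow> poly (root_product n) t > 0"
  by (induction n arbitrary: t) (auto simp: poly_pcompose)

text \<open>
On \<open>(0,n+1)\<close> the sine of \<open>\<pi>t\<close> and the product change sign at the same points \<open>1, \<dots>, n\<close>, and
both are positive on \<open>(0,1)\<close>. Passing from \<open>t\<close> to \<open>t - 1\<close> removes the factor \<open>1 - t\<close> and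
reverses the sign of sine and cosine, which gives the induction.
\<close>

lemma root_product_sin_sign:
  assumes "0 < t" "t < real n + 1"
  defines "q \<equiv> root_product n"
  shows "poly q t * sin (pi * t) > 0 \<or>
    (poly q t = 0 \<and> sin (pi * t) = 0 \<and> poly (pderiv q) t * cos (pi * t) > 0)"
  using assms(1,2) unfolding q_def
proof (induction n arbitrary: t)
  case 0
  thus ?case by (simp add: sin_gt_zero)
next
  case (Suc n)
  let ?q = "root_product n"
  have q: "poly (root_product (Suc n)) t = (1 - t) * poly ?q (t - 1)"
    by (simp add: poly_pcompose algebra_simps)
  have q': "poly (pderiv (root_product (Suc n))) t = (1 - t) * poly (pderiv ?q) (t - 1) - poly ?q (t - 1)"
    unfolding root_product.simps pderiv_mult pderiv_pcompose
    by (simp add: poly_pcompose pderiv_pCons algebra_simps)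
  have s: "sin (pi * t) = - sin (pi * (t - 1))" and c: "cos (pi * t) = - cos (pi * (t - 1))"
    by (simp_all add: right_diff_distrib sin_diff cos_diff)
  consider "t < 1" | "t = 1" | "t > 1" by linarith
  thus ?case
  proof cases
    case 1
    hence "poly (root_product (Suc n)) t > 0" by (rule root_product_pos)
    moreover have "sin (pi * t) > 0" using 1 Suc.prems by (simp add: sin_gt_zero)
    ultimately show ?thesis by simp
  next
    case 2
    have "poly (pderiv (root_product (Suc n))) t < 0"
      unfolding q' using 2 root_product_pos[of 0 n] by simp
    thus ?thesis unfolding q using 2 by simp
  next
    case 3
    have IH: "poly ?q (t - 1) * sin (pi * (t - 1)) > 0 \<or>
       poly ?q (t - 1) = 0 \<and> sin (pi * (t - 1)) = 0 \<and> poly (pderiv ?q) (t - 1) * cos (pi * (t - 1)) > 0"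
      using 3 Suc.prems by (intro Suc.IH) auto
    thus ?thesis
    proof
      assume "poly ?q (t - 1) * sin (pi * (t - 1)) > 0"
      hence "(t - 1) * (poly ?q (t - 1) * sin (pi * (t - 1))) > 0" using 3 by simp
      thus ?thesis unfolding q s by (simp add: algebra_simps)
    next
      assume *:
          "poly ?q (t - 1) = 0 \<and> sin (pi * (t - 1)) = 0 \<and> poly (pderiv ?q) (t - 1) * cos (pi * (t - 1)) > 0"
      hence "(t - 1) * (poly (pderiv ?q) (t - 1) * cos (pi * (t - 1))) > 0" using 3 by simp
      thus ?thesis unfolding q q' s c using * by (simp add: algebra_simps)
    qed
  qed
qed

text \<open>
With \<open>\<pi>t = \<omega>x/2 + (n+1)\<pi>/2\<close> the interval \<open>[-1,1]\<close> is mapped into \<open>(0,n+1)\<close>. Expanding \<open>sin(\<pi>t)\<close>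
and \<open>cos(\<pi>t)\<close> by the addition theorems shows that \<open>q sin(\<pi>t) + \<epsilon> q' cos(\<pi>t)\<close> is the real part of
\<open>(a + ib) e\<^sup>i\<^sup>\<omega>\<^sup>x\<^sup>/\<^sup>2\<close> for suitable \<open>a\<close>, \<open>b\<close> of degree at most \<open>n\<close>.
\<close>

lemma ex_positive_real_part:
  assumes "0 < \<omega>" "\<omega> < (real n + 1) * pi"
  shows "\<exists>a b :: real poly. degree a \<le> n \<and> degree b \<le> n \<and>
    (\<forall>x\<in>{-1..1}. poly a x * cos (\<omega> * x / 2) - poly b x * sin (\<omega> * x / 2) > 0)"
proof -
  define c where "c = (real n + 1) * pi / 2"
  define l where "l = [:(real n + 1) / 2, \<omega> / (2 * pi):]"
  define q q' where "q = pcompose (root_product n) l" and "q' = pcompose (pderiv (root_product n)) l"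
  have arg: "pi * poly l x = \<omega> * x / 2 + c" for x
    by (simp add: l_def c_def field_simps)
  define F G where "F = (\<lambda>x. poly q x * sin (\<omega> * x / 2 + c))"
    and "G = (\<lambda>x. poly q' x * cos (\<omega> * x / 2 + c))"
  have sgn: "F x > 0 \<or> F x = 0 \<and> G x > 0" if "x \<in> {-1..1}" for x
  proof -
    have "\<bar>\<omega> * x\<bar> < (real n + 1) * pi"
    proof -
      have "\<omega> * \<bar>x\<bar> \<le> \<omega>" using that assms(1) by (intro mult_left_le) auto
      hence "\<omega> * \<bar>x\<bar> < (real n + 1) * pi" using assms(2) by linarith
      thus ?thesis using assms(1) by (simp add: abs_mult)
    qed
    moreover have "2 * pi * poly l x = (real n + 1) * pi + \<omega> * x"
      by (simp add: l_def field_simps)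
    ultimately have "0 < 2 * pi * poly l x" "2 * pi * poly l x < 2 * pi * (real n + 1)"
      by (auto simp: abs_less_iff algebra_simps)
    hence "0 < poly l x" "poly l x < real n + 1"
      by (simp_all add: zero_less_mult_iff)
    from root_product_sin_sign[OF this] show ?thesis
      unfolding F_def G_def q_def q'_def poly_pcompose arg by auto
  qed
  have cont: "continuous_on {-1..1} F" "continuous_on {-1..1} G"
    unfolding F_def G_def by (intro continuous_intros; simp)+
  have "\<exists>\<epsilon>0>0. \<forall>\<epsilon>. 0 < \<epsilon> \<and> \<epsilon> \<le> \<epsilon>0 \<longrightarrow> (\<forall>x\<in>{-1..1}. F x + \<epsilon> * G x > 0)"
    by (rule positive_perturbation[OF compact_Icc cont]) (use sgn in force)+
  then obtain \<epsilon> where \<epsilon>: "\<And>x. x \<in> {-1..1} \<Longrightarrow> F x + \<epsilon> * G x > 0"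
    by blast
  define a where "a = smult (sin c) q + smult (\<epsilon> * cos c) q'"
  define b where "b = smult (\<epsilon> * sin c) q' - smult (cos c) q"
  have "degree q \<le> n" "degree q' \<le> n"
    using degree_root_product[of n] degree_pderiv[of "root_product n"]
    by (auto simp: q_def q'_def l_def degree_pcompose assms(1))
  hence "degree a \<le> n" "degree b \<le> n"
    unfolding a_def b_def by (auto intro!: degree_add_le degree_diff_le degree_smult_le[THEN order_trans])
  moreover have "poly a x * cos (\<omega> * x / 2) - poly b x * sin (\<omega> * x / 2) > 0" if "x \<in> {-1..1}" for x
  proof -
    have "poly a x * cos (\<omega> * x / 2) - poly b x * sin (\<omega> * x / 2) = F x + \<epsilon> * G x"
      by (simp add: a_def b_def F_def G_def sin_add cos_add algebra_simps)
    thus ?thesis using \<epsilon>[OF that] by simp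
  qed
  ultimately show ?thesis by blast
qed

lemma best_approx_err_less_2:
  assumes "0 < \<omega>" "\<omega> < (real n + 1) * pi" "best_approx n \<omega> r"
  shows "approx_err \<omega> r < 2"
proof -
  obtain a b :: "real poly" where ab: "degree a \<le> n" "degree b \<le> n" "half_plane \<omega> a b"
    using ex_positive_real_part[OF assms(1,2)] unfolding half_plane_def rot_re_def by blast
  have "approx_err \<omega> r \<le> approx_err \<omega> (urat a b)"
    using assms(3) urat_in_unitary_rat[OF ab(1,2) half_plane_nonzero[OF ab(3)]]
    unfolding best_approx_def by blast
  thus ?thesis using approx_err_half_plane_less_2[OF ab(3)] by simp
qed

section \<open>Phase functions\<close>

text \<open>
Each summand is half the argument of the factor \<open>cnj (ix - s) / (ix - s)\<close> of \<open>cnj p / p\<close>.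
\<close>

lemma cis_sum_arctan:
  assumes "\<And>s. s \<in># M \<Longrightarrow> Re s \<noteq> 0"
  shows "cis (2 * (\<Sum>s\<in>#M. arctan ((x - Im s) / Re s))) =
    (\<Prod>s\<in>#M. cnj (\<i> * of_real x - s) / (\<i> * of_real x - s))"
  using assms
proof (induction M)
  case (add s M)
  let ?t = "(x - Im s) / Re s"
  have "Re s \<noteq> 0" using add.prems by simp
  hence "cnj (\<i> * of_real x - s) = of_real (- Re s) * Complex 1 ?t"
      "\<i> * of_real x - s = of_real (- Re s) * Complex 1 (- ?t)"
    by (simp_all add: complex_eq_iff)
  hence "cnj (\<i> * of_real x - s) / (\<i> * of_real x - s) = cis (2 * arctan ?t)"
    using \<open>Re s \<noteq> 0\<close> unfolding cis_double_arctan
        by (metis mult_divide_mult_cancel_left neg_equal_0_iff_equal of_real_eq_0_iff)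
  thus ?case using add by (simp add: cis_mult[symmetric] distrib_left)
qed simp

lemma cnj_poly_divide:
  fixes p :: "complex poly"
  assumes "p \<noteq> 0"
  shows "cnj (poly p z) / poly p z = cnj (lead_coeff p) / lead_coeff p * (\<Prod>s\<in>#proots p. cnj (z -
      s) / (z - s))"
proof -
  have prod: "poly (\<Prod>s\<in>#M. [:-s, 1:]) z = (\<Prod>s\<in>#M. z - s)" for M :: "complex multiset"
    by (induction M) (auto simp: algebra_simps)
  have "cnj (\<Prod>s\<in>#M. z - s) / (\<Prod>s\<in>#M. z - s) = (\<Prod>s\<in>#M. cnj (z - s) / (z - s))" for M :: "complex multiset"
  proof (induction M)
    case (add s M)
    show ?case
      unfolding image_mset_add_mset prod_mset.add_mset complex_cnj_mult times_divide_times_eq[symmetric] add.IH ..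
  qed simp
  moreover have "poly p z = lead_coeff p * (\<Prod>s\<in>#proots p. z - s)"
    by (subst complex_poly_decompose_multiset[symmetric]) (simp add: prod)
  moreover have "cnj (c * d) / (c * d) = cnj c / c * (cnj d / d)" for c d :: complex by simp
  ultimately show ?thesis by metis
qed

lemma ex_phase_form:
  assumes "coprime a b"
  obtains \<theta> where "\<And>x. rat_eval (urat a b) (\<i> * of_real x) =
    cis (\<theta> + 2 * (\<Sum>s\<in>#poles (urat a b). arctan ((x - Im s) / Re s)))"
proof -
  let ?p = "axis_poly a b"
  define c where "c = lead_coeff ?p"
  have nz: "?p \<noteq> 0" using assms by (auto dest: coprime_pair_nonzero)
  hence "c \<noteq> 0" by (simp add: c_def)
  hence "norm (cnj c / c) = 1" by (simp add: norm_divide)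
  then obtain \<theta> where \<theta>: "cnj c / c = cis \<theta>"
      by (metis cis_Arg norm_eq_zero zero_neq_one sgn_eq div_by_1 of_real_1)
  have "rat_eval (urat a b) (\<i> * of_real x) =
    cis (\<theta> + 2 * (\<Sum>s\<in>#poles (urat a b). arctan ((x - Im s) / Re s)))" for x
  proof -
    have "rat_eval (urat a b) (\<i> * of_real x) = cnj (poly ?p (\<i> * of_real x)) / poly ?p (\<i> * of_real x)"
      unfolding poly_axis_poly by (rule rat_eval_urat[OF coprime_no_common_root[OF assms]])
    also have "\<dots> = cis \<theta> * (\<Prod>s\<in>#poles (urat a b). cnj (\<i> * of_real x - s) / (\<i> * of_real x - s))"
      unfolding cnj_poly_divide[OF nz] c_def[symmetric] \<theta> poles_urat[OF assms] ..
    also have "\<dots> = cis \<theta> * cis (2 * (\<Sum>s\<in>#poles (urat a b). arctan ((x - Im s) / Re s)))"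
      using poles_urat_Re[OF assms] by (subst cis_sum_arctan) auto
    finally show ?thesis by (simp add: cis_mult)
  qed
  thus ?thesis using that by blast
qed

lemma continuous_on_sum_mset [continuous_intros]:
  fixes f :: "'a \<Rightarrow> 'b::topological_space \<Rightarrow> real"
  shows "(\<And>s. s \<in># M \<Longrightarrow> continuous_on S (f s)) \<Longrightarrow> continuous_on S (\<lambda>x. \<Sum>s\<in>#M. f s x)"
  by (induction M) (auto intro: continuous_on_add)

lemma continuous_on_phase_form:
  assumes "\<And>s. s \<in># M \<Longrightarrow> Re s \<noteq> 0"
  shows "continuous_on S (\<lambda>x. \<theta> + 2 * (\<Sum>s\<in>#M. arctan ((x - Im s) / Re s)))"
  using assms by (intro continuous_intros) auto

lemma continuous_on_phase_error:
  assumes "r \<in> unitary_rat n" "phase_function \<omega> r g"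
  shows "continuous_on S (phase_error \<omega> g)"
proof -
  obtain a b where r: "r = urat a b" "coprime a b" using assms(1) by (rule unitary_rat_cases)
  obtain \<theta> where "\<forall>x. g x = \<theta> + 2 * (\<Sum>s\<in>#poles r. arctan ((x - Im s) / Re s))"
    using assms(2) unfolding phase_function_def by blast
  hence g: "g = (\<lambda>x. \<theta> + 2 * (\<Sum>s\<in>#poles r. arctan ((x - Im s) / Re s)))" by blast
  have "continuous_on S g"
    unfolding g using poles_urat_Re[OF r(2)] r(1) by (intro continuous_on_phase_form) auto
  thus ?thesis unfolding phase_error_def by (intro continuous_intros)
qed

lemma norm_err_phase:
  assumes "phase_function \<omega> r g"
  shows "norm (rat_eval r (\<i> * of_real x) - exp (of_real \<omega> * (\<i> * of_real x))) =
    2 * \<bar>sin (phase_error \<omega> g x / 2)\<bar>"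
  using assms unfolding phase_function_def exp_times_ii phase_error_def
  by (simp add: norm_cis_diff flip: cis_conv_exp)

text \<open>
Since the error is below \<open>2\<close>, the phase error avoids the odd multiples of \<open>\<pi>\<close>. Normalising it
at \<open>x = 0\<close> to lie in \<open>(-\<pi>,\<pi>)\<close> therefore keeps it there on all of \<open>[-1,1]\<close>.
\<close>

lemma ex_phase_function:
  assumes "r \<in> unitary_rat n" "approx_err \<omega> r < 2"
  obtains g where "phase_function \<omega> r g"
proof -
  obtain a b where r: "r = urat a b" "coprime a b" using assms(1) by (rule unitary_rat_cases)
  obtain \<theta> where \<theta>: "\<And>x. rat_eval r (\<i> * of_real x) =
      cis (\<theta> + 2 * (\<Sum>s\<in>#poles r. arctan ((x - Im s) / Re s)))"
    unfolding r(1) using ex_phase_form[OF r(2)] by blast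
  define g where
      "g k x = (\<theta> - 2 * pi * of_int k) + 2 * (\<Sum>s\<in>#poles r. arctan ((x - Im s) / Re s))" for k :: int and x
  have cis_g: "rat_eval r (\<i> * of_real x) = cis (g k x)" for k x
  proof -
    have "cis (g k x) = cis (g k x + 2 * pi * of_int k)" by (simp flip: cis_mult)
    thus ?thesis by (simp add: g_def \<theta> algebra_simps)
  qed
  define k where "k = \<lfloor>(g 0 0 + pi) / (2 * pi)\<rfloor>"
  let ?e = "phase_error \<omega> (g k)"
  have cont: "continuous_on {-1..1} ?e"
    unfolding phase_error_def g_def using poles_urat_Re[OF r(2)] r(1)
    by (intro continuous_intros) auto
  have ne: "?e x \<noteq> pi" "?e x \<noteq> - pi" if x: "x \<in> {-1..1}" for x
  proof -
    have "norm (cis (g k x) - cis (\<omega> * x)) < 2"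
      using norm_le_max_norm[OF continuous_on_err[OF assms(1)] x, of \<omega>] assms(2)
      unfolding approx_err_def exp_times_ii cis_g[of _ k] by linarith
    hence "\<bar>sin (?e x / 2)\<bar> < 1" by (simp add: norm_cis_diff phase_error_def)
    thus "?e x \<noteq> pi" "?e x \<noteq> - pi" by auto
  qed
  have "of_int k \<le> (g 0 0 + pi) / (2 * pi)" "(g 0 0 + pi) / (2 * pi) < of_int k + 1"
    unfolding k_def by linarith+
  hence "of_int k * (2 * pi) \<le> g 0 0 + pi" "g 0 0 + pi < (of_int k + 1) * (2 * pi)"
    by (simp_all add: pos_le_divide_eq pos_divide_less_eq)
  hence "- pi \<le> ?e 0" "?e 0 < pi" by (simp_all add: phase_error_def g_def algebra_simps)
  hence e0: "- pi < ?e 0" "?e 0 < pi" using ne[of 0] by auto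
  have "(\<forall>x\<in>{-1..1}. pi - ?e x > 0) \<or> (\<forall>x\<in>{-1..1}. pi - ?e x < 0)"
    by (intro nonzero_imp_constant_sign continuous_intros cont) (use ne in fastforce)
  moreover have "(\<forall>x\<in>{-1..1}. ?e x + pi > 0) \<or> (\<forall>x\<in>{-1..1}. ?e x + pi < 0)"
    by (intro nonzero_imp_constant_sign continuous_intros cont) (use ne in fastforce)
  ultimately have "\<forall>x\<in>{-1..1}. \<bar>?e x\<bar> < pi"
    using e0 by (smt (verit) atLeastAtMost_iff)
  hence "max_norm ?e < pi" using max_norm_less_iff[OF cont] by simp
  hence "phase_function \<omega> r (g k)"
    unfolding phase_function_def cis_conv_exp[symmetric] using cis_g[of _ k]
    by (intro conjI exI[of _ "\<theta> - 2 * pi * of_int k"]) (auto simp: g_def)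
  thus ?thesis using that by blast
qed

lemma cis_eq_imp_eq:
  assumes "cis s = cis t" "\<bar>s\<bar> < pi" "\<bar>t\<bar> < pi"
  shows "s = t"
proof -
  have "sin ((s - t) / 2) = 0" using norm_cis_diff[of s t] assms(1) by simp
  moreover have "\<bar>s - t\<bar> < 2 * pi" using assms by linarith
  ultimately show ?thesis using sin_eq_0_pi[of "(s - t) / 2"] by (auto simp: abs_less_iff)
qed

lemma phase_error_eq_arctan:
  assumes "half_plane \<omega> a b" "urat a b \<in> unitary_rat n" "phase_function \<omega> (urat a b) g" "x \<in> {-1..1}"
  shows "phase_error \<omega> g x = - 2 * arctan (tan_err \<omega> a b x)"
proof (rule cis_eq_imp_eq)
  let ?E = "tan_err \<omega> a b x"
  have "cis (g x) = cis (\<omega> * x - 2 * arctan ?E)"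
    using assms(3) rat_eval_half_plane[OF assms(1,4)] unfolding phase_function_def
        by (simp add: cis_conv_exp)
  hence "cis (g x) / cis (\<omega> * x) = cis (\<omega> * x - 2 * arctan ?E) / cis (\<omega> * x)" by simp
  thus "cis (phase_error \<omega> g x) = cis (- 2 * arctan ?E)"
    by (simp add: cis_divide phase_error_def)
  show "\<bar>- 2 * arctan ?E\<bar> < pi" using arctan_bounded[of ?E] by (simp add: abs_less_iff)
  have "max_norm (phase_error \<omega> g) < pi"
    using assms(3) approx_err_half_plane_less_2[OF assms(1)] unfolding phase_function_def by simp
  thus "\<bar>phase_error \<omega> g x\<bar> < pi"
    using norm_le_max_norm[OF continuous_on_phase_error[OF assms(2,3)] assms(4)] by simp
qed

lemma max_norm_phase_error:
  assumes "half_plane \<omega> a b" "urat a b \<in> unitary_rat n" "phase_function \<omega> (urat a b) g"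
  shows "max_norm (phase_error \<omega> g) = 2 * arctan (max_norm (tan_err \<omega> a b))"
proof -
  have *: "norm (phase_error \<omega> g x) = 2 * arctan \<bar>tan_err \<omega> a b x\<bar>" if "x \<in> {-1..1}" for x
    using phase_error_eq_arctan[OF assms that] by (simp add: abs_mult abs_if arctan_minus)
  obtain x where "x \<in> {-1..1}" "\<bar>tan_err \<omega> a b x\<bar> = max_norm (tan_err \<omega> a b)"
      "\<And>y. y \<in> {-1..1} \<Longrightarrow> \<bar>tan_err \<omega> a b y\<bar> \<le> max_norm (tan_err \<omega> a b)"
    using max_norm_attained[OF continuous_on_tan_err[OF assms(1)]] by auto
  thus ?thesis
    unfolding max_norm_def[of "phase_error \<omega> g"] using *
    by (intro cSup_eq_maximum) (auto simp: arctan_le_iff intro!: image_eqI[of _ _ x])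
qed

section \<open>Critical points of the phase error\<close>

lemma sum_mset_eq_sum_count:
  fixes f :: "'a \<Rightarrow> real"
  shows "(\<Sum>s\<in>#M. f s) = (\<Sum>s\<in>set_mset M. real (count M s) * f s)"
proof -
  have "(\<Sum>s\<in>#M. f s) = (\<Sum>s\<in>A. real (count M s) * f s)" if "finite A" "set_mset M \<subseteq> A" for A
    using that(2)
  proof (induction M)
    case (add x M)
    have "(\<Sum>s\<in>A. real (count (add_mset x M) s) * f s) =
        (\<Sum>s\<in>A. real (count M s) * f s + (if s = x then f s else 0))"
      by (intro sum.cong) (auto simp: algebra_simps)
    also have "\<dots> = (\<Sum>s\<in>A. real (count M s) * f s) + f x"
      using add.prems that(1) by (simp add: sum.distrib)
    finally show ?case using add by simp
  qed simp
  thus ?thesis by simp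
qed

text \<open>
The derivative is a sum of terms \<open>2 Re s / ((Re s)\<^sup>2 + (x - Im s)\<^sup>2)\<close> minus \<open>\<omega>\<close>. Repeated poles
share a denominator, so the degree of the common denominator counts distinct poles only. The
numerator is not zero because its coefficient in degree \<open>2 card (set_mset M)\<close> is \<open>-\<omega>\<close>.
\<close>

lemma ex_rational_deriv:
  fixes M :: "complex multiset"
  assumes Re: "\<And>s. s \<in># M \<Longrightarrow> Re s \<noteq> 0" and \<omega>: "\<omega> > 0"
    and g: "\<And>x. g x = \<theta> + 2 * (\<Sum>s\<in>#M. arctan ((x - Im s) / Re s))"
  obtains N D :: "real poly" where "N \<noteq> 0" "degree N \<le> 2 * card (set_mset M)" "\<And>x. poly D x > 0"
    "\<And>x. (phase_error \<omega> g has_real_derivative poly N x / poly D x) (at x)"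
proof -
  define S where "S = set_mset M"
  define q where "q s = [:(Re s)\<^sup>2 + (Im s)\<^sup>2, - 2 * Im s, 1:]" for s
  have S: "finite S" "\<And>s. s \<in> S \<Longrightarrow> Re s \<noteq> 0" using Re by (auto simp: S_def)
  have q: "poly (q s) x = (Re s)\<^sup>2 + (x - Im s)\<^sup>2" for s x
    by (simp add: q_def power2_eq_square algebra_simps)
  have q_pos: "poly (q s) x > 0" if "s \<in> S" for s x
    unfolding q using S(2)[OF that] by (simp add: add_pos_nonneg)
  have q_deg: "degree (q s) = 2" "q s \<noteq> 0" for s by (simp_all add: q_def)
  define D where "D = (\<Prod>s\<in>S. q s)"
  define R where "R = (\<Sum>s\<in>S. smult (2 * real (count M s) * Re s) (\<Prod>t\<in>S - {s}. q t))"
  define N where "N = R - smult \<omega> D"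
  have D_pos: "poly D x > 0" for x unfolding D_def poly_prod by (intro prod_pos q_pos)
  have deg_D: "degree D = 2 * card S"
    unfolding D_def by (subst degree_prod_sum_eq) (auto simp: q_deg)
  have coeff_D: "coeff D (2 * card S) = 1"
    using lead_coeff_prod[of q S] unfolding deg_D[symmetric] D_def[symmetric]
    by (simp add: q_deg) (simp add: q_def numeral_2_eq_2)
  have coeff_R: "coeff R k = 0" if "k \<ge> 2 * card S" for k
    unfolding R_def coeff_sum
  proof (intro sum.neutral ballI)
    fix s assume s: "s \<in> S"
    have "degree (\<Prod>t\<in>S - {s}. q t) = 2 * (card S - 1)"
      using s S(1) by (subst degree_prod_sum_eq) (auto simp: q_deg)
    moreover have "card S > 0" using s S(1) by (auto simp: card_gt_0_iff)
    ultimately have "coeff (\<Prod>t\<in>S - {s}. q t) k = 0" using that by (intro coeff_eq_0) auto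
    thus "coeff (smult (2 * real (count M s) * Re s) (\<Prod>t\<in>S - {s}. q t)) k = 0" by simp
  qed
  have "coeff N (2 * card S) = - \<omega>" by (simp add: N_def coeff_R coeff_D)
  hence "N \<noteq> 0" using \<omega> by auto
  moreover have "degree N \<le> 2 * card S"
    by (rule degree_le) (simp add: N_def coeff_R coeff_eq_0 deg_D)
  moreover have "(phase_error \<omega> g has_real_derivative poly N x / poly D x) (at x)" for x
  proof -
    have "((\<lambda>x. arctan ((x - Im s) / Re s)) has_real_derivative Re s / poly (q s) x) (at x)"
        if "s \<in> S" for s
    proof -
      have "((\<lambda>x. arctan ((x - Im s) / Re s)) has_real_derivative
              inverse (1 + ((x - Im s) / Re s)\<^sup>2) * (1 / Re s)) (at x)"
        using S(2)[OF that] by (auto intro!: derivative_eq_intros)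
      also have "inverse (1 + ((x - Im s) / Re s)\<^sup>2) * (1 / Re s) = Re s / poly (q s) x"
        unfolding q using S(2)[OF that] q_pos[OF that, of x, unfolded q]
        by (simp add: field_simps power2_eq_square)
      finally show ?thesis .
    qed
    hence "((\<lambda>x. \<Sum>s\<in>S. real (count M s) * arctan ((x - Im s) / Re s)) has_real_derivative
        (\<Sum>s\<in>S. real (count M s) * (Re s / poly (q s) x))) (at x)"
      by (intro DERIV_sum DERIV_cmult)
    moreover have
        "phase_error \<omega> g = (\<lambda>x. \<theta> + 2 * (\<Sum>s\<in>S. real (count M s) * arctan ((x - Im s) / Re s)) - \<omega> * x)"
      by (simp add: fun_eq_iff phase_error_def g sum_mset_eq_sum_count S_def)
    moreover have "((\<lambda>x. \<theta> + 2 * F x - \<omega> * x) has_real_derivative 2 * d - \<omega>) (at x)"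
      if "(F has_real_derivative d) (at x)" for F d
      using that by (auto intro!: derivative_eq_intros)
    ultimately have "(phase_error \<omega> g has_real_derivative
        2 * (\<Sum>s\<in>S. real (count M s) * (Re s / poly (q s) x)) - \<omega>) (at x)"
      by simp
    moreover have "2 * (\<Sum>s\<in>S. real (count M s) * (Re s / poly (q s) x)) - \<omega> = poly N x / poly D x"
    proof -
      have "poly R x = (\<Sum>s\<in>S. 2 * (real (count M s) * (Re s / poly (q s) x)) * poly D x)"
        unfolding R_def poly_sum
      proof (intro sum.cong refl)
        fix s assume s: "s \<in> S"
        have "poly D x = poly (q s) x * poly (\<Prod>t\<in>S - {s}. q t) x"
          unfolding D_def by (subst prod.remove[OF S(1) s]) simp
        thus "poly (smult (2 * real (count M s) * Re s) (\<Prod>t\<in>S - {s}. q t)) x =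
            2 * (real (count M s) * (Re s / poly (q s) x)) * poly D x"
          using q_pos[OF s, of x] by simp
      qed
      also have "\<dots> = 2 * (\<Sum>s\<in>S. real (count M s) * (Re s / poly (q s) x)) * poly D x"
        by (simp add: sum_distrib_left sum_distrib_right)
      finally show ?thesis using D_pos[of x] by (simp add: N_def diff_divide_distrib)
    qed
    ultimately show ?thesis by simp
  qed
  ultimately show ?thesis using that D_pos unfolding S_def by blast
qed

lemma phase_function_derivE:
  assumes "r = urat a b" "coprime a b" "\<omega> > 0" "phase_function \<omega> r g"
  obtains N D :: "real poly" where "N \<noteq> 0" "degree N \<le> 2 * card (set_mset (poles r))" "\<And>x. poly D x > 0"
    "\<And>x. (phase_error \<omega> g has_real_derivative poly N x / poly D x) (at x)"
proof -
  obtain \<theta> where g: "\<And>x. g x = \<theta> + 2 * (\<Sum>s\<in>#poles r. arctan ((x - Im s) / Re s))"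
    using assms(4) unfolding phase_function_def by blast
  have "Re s \<noteq> 0" if "s \<in># poles r" for s using poles_urat_Re[OF assms(2)] that assms(1) by simp
  thus ?thesis using ex_rational_deriv[OF _ assms(3) g] that by blast
qed

definition extremal_points :: "(real \<Rightarrow> real) \<Rightarrow> real set" where
  "extremal_points e = {x \<in> {-1..1}. \<bar>e x\<bar> = max_norm e}"

text \<open>
A single extremal point is already an alternation of length one.
\<close>

lemma equioscillation_points_eq:
  assumes "continuous_on {-1..1} e"
  shows "equioscillation_points e = extremal_points e"
proof (intro equalityI subsetI)
  fix x assume "x \<in> equioscillation_points e"
  then obtain m \<eta> j where *: "equioscillates_at e m \<eta>" "j \<in> {1..m}" "x = \<eta> j"
    unfolding equioscillation_points_def by auto
  then obtain \<iota> :: nat where "e x = (-1) ^ (j + \<iota>) * max_norm e" unfolding equioscillates_at_def by blast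
  hence "\<bar>e x\<bar> = max_norm e" using max_norm_nonneg[OF assms] by (simp add: abs_mult)
  moreover have "x \<in> {-1..1}" using * unfolding equioscillates_at_def by blast
  ultimately show "x \<in> extremal_points e" by (simp add: extremal_points_def)
next
  fix x assume x: "x \<in> extremal_points e"
  define \<iota> :: nat where "\<iota> = (if e x \<ge> 0 then 1 else 0)"
  have "equioscillates_at e 1 (\<lambda>_. x)"
    unfolding equioscillates_at_def using x
    by (auto simp: extremal_points_def strict_mono_on_def \<iota>_def intro!: bexI[of _ \<iota>])
  thus "x \<in> equioscillation_points e"
    unfolding equioscillation_points_def by force
qed

lemma interior_extremal_deriv:
  assumes "continuous_on {-1..1} e" "x \<in> extremal_points e" "x \<in> {-1<..<1}"
    "(e has_real_derivative d) (at x)"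
  shows "d = 0"
proof -
  define h where "h = min (x + 1) (1 - x)"
  have h: "h > 0" using assms(3) by (simp add: h_def)
  have near: "\<bar>e y\<bar> \<le> \<bar>e x\<bar>" if "\<bar>x - y\<bar> < h" for y
  proof -
    have "y \<in> {-1..1}" using that by (auto simp: h_def)
    thus ?thesis using norm_le_max_norm[OF assms(1)] assms(2) by (auto simp: extremal_points_def)
  qed
  show ?thesis
  proof (cases "e x \<ge> 0")
    case True
    show ?thesis
      by (rule DERIV_local_max[OF assms(4) h]) (use near True in force)
  next
    case False
    show ?thesis
      by (rule DERIV_local_min[OF assms(4) h]) (use near False in force)
  qed
qed

section \<open>Alternation and separating polynomials\<close>

text \<open>
\<open>alt_chain k P Q x\<close>: there are \<open>k + 1\<close> increasing points, alternately from \<open>P\<close> and \<open>Q\<close>, the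
largest of which is \<open>x\<close> and lies in \<open>P\<close>.
\<close>

primrec alt_chain :: "nat \<Rightarrow> real set \<Rightarrow> real set \<Rightarrow> real \<Rightarrow> bool" where
  "alt_chain 0 P Q x \<longleftrightarrow> x \<in> P"
| "alt_chain (Suc k) P Q x \<longleftrightarrow> x \<in> P \<and> (\<exists>y<x. alt_chain k Q P y)"

lemma alt_chain_end: "alt_chain k P Q x \<Longrightarrow> x \<in> P"
  by (cases k) auto

lemma alt_chain_mono:
  assumes "alt_chain k P Q x" "\<And>z. z \<le> x \<Longrightarrow> z \<in> P \<Longrightarrow> z \<in> P'" "\<And>z. z \<le> x \<Longrightarrow> z \<in> Q \<Longrightarrow> z \<in> Q'"
  shows "alt_chain k P' Q' x"
  using assms
proof (induction k arbitrary: P Q P' Q' x)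
  case (Suc k)
  then obtain y where y: "x \<in> P" "y < x" "alt_chain k Q P y" by auto
  have "alt_chain k Q' P' y"
    by (rule Suc.IH[OF y(3)]) (use y(2) Suc.prems(2,3) in \<open>meson less_imp_le order_trans\<close>)+
  thus ?case using y(1,2) Suc.prems(2) by auto
qed auto

text \<open>
Induction on the degree. Let \<open>p\<close> be the largest point of \<open>P\<close>, and split \<open>Q\<close> at \<open>p\<close>. A long
chain ending in the lower part of \<open>Q\<close> could be prolonged by \<open>p\<close>; so the induction hypothesis
separates this part from all of \<open>P\<close>, and also from the upper part of \<open>Q\<close>, which no such chain
reaches. One further sign change just above \<open>p\<close> then gives the required signs.
\<close>

lemma ex_separating_poly:
  fixes P Q :: "real set"
  assumes "closed P" "closed Q" "bdd_above P" "P \<inter> Q = {}"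
    and "\<And>x. \<not> alt_chain k P Q x"
  shows "\<exists>N. degree N \<le> k \<and> (\<forall>x\<in>P. poly N x < 0) \<and> (\<forall>x\<in>Q. poly N x > 0)"
  using assms
proof (induction k arbitrary: P Q)
  case 0
  hence "P = {}" by auto
  thus ?case by (intro exI[of _ 1]) auto
next
  case (Suc k)
  show ?case
  proof (cases "P = {}")
    case True
    thus ?thesis by (intro exI[of _ 1]) auto
  next
    case False
    define p where "p = Sup P"
    have p: "p \<in> P" "\<And>x. x \<in> P \<Longrightarrow> x \<le> p"
      using False Suc.prems by (auto simp: p_def intro: closed_contains_Sup cSup_upper)
    have "p \<in> - Q" using p(1) Suc.prems by auto
    then obtain e where e: "e > 0" "ball p e \<subseteq> - Q"
      using Suc.prems(2) by (metis open_Compl openE)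
    define z where "z = p + e / 2"
    have Qz: "x < p \<or> z < x" if "x \<in> Q" for x
    proof -
      have "x \<notin> ball p e" using e that by auto
      thus ?thesis using e(1) by (auto simp: z_def dist_real_def)
    qed
    let ?Q1 = "Q \<inter> {..p}" and ?Q2 = "Q \<inter> {p..}"
    have "\<exists>M. degree M \<le> k \<and> (\<forall>x\<in>?Q1. poly M x < 0) \<and> (\<forall>x\<in>P \<union> ?Q2. poly M x > 0)"
    proof (rule Suc.IH)
      show "closed ?Q1" "closed (P \<union> ?Q2)" using Suc.prems by auto
      show "bdd_above ?Q1" by auto
      show "?Q1 \<inter> (P \<union> ?Q2) = {}" using Suc.prems p(1) by (auto dest: antisym)
      show "\<not> alt_chain k ?Q1 (P \<union> ?Q2) x" for x
      proof
        assume *: "alt_chain k ?Q1 (P \<union> ?Q2) x"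
        have x: "x < p" using alt_chain_end[OF *] Qz e(1) by (fastforce simp: z_def)
        have "alt_chain k Q P x"
          by (rule alt_chain_mono[OF *]) (use x in auto)
        hence "alt_chain (Suc k) P Q p" using x p(1) by auto
        thus False using Suc.prems by blast
      qed
    qed
    then obtain M where M: "degree M \<le> k" "\<And>x. x \<in> ?Q1 \<Longrightarrow> poly M x < 0"
        "\<And>x. x \<in> P \<union> ?Q2 \<Longrightarrow> poly M x > 0" by blast
    define N where "N = [:-z, 1:] * M"
    have N: "poly N x = (x - z) * poly M x" for x by (simp add: N_def algebra_simps)
    have "degree N \<le> Suc k"
      using degree_mult_le[of "[:-z, 1:]" M] M(1) unfolding N_def by simp
    moreover have "poly N x < 0" if "x \<in> P" for x
      using that p(2)[OF that] M(3)[of x] e(1) unfolding N z_def by (intro mult_neg_pos) auto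
    moreover have "poly N x > 0" if "x \<in> Q" for x
    proof (cases "x < p")
      case True
      thus ?thesis using that M(2)[of x] e(1) unfolding N z_def by (intro mult_neg_neg) auto
    next
      case False
      hence "x > z" using Qz[OF that] by auto
      thus ?thesis using that M(3)[of x] e(1) unfolding N by (intro mult_pos_pos) (auto simp: z_def)
    qed
    ultimately show ?thesis by blast
  qed
qed

text \<open>
A chain that ends in the set without the largest point overall can be prolonged by that point.
So these chains are shorter by one, and \<open>ex_separating_poly\<close> applied to them yields a polynomial
of one degree less.
\<close>

lemma separating_poly_or_alt_chain:
  fixes P Q :: "real set"
  assumes "compact P" "compact Q" "P \<inter> Q = {}"
    and "\<And>x. \<not> alt_chain (Suc k) P Q x" "\<And>x. \<not> alt_chain (Suc k) Q P x"
  shows "\<exists>N. degree N \<le> k \<and> (\<forall>x\<in>P. poly N x < 0) \<and> (\<forall>x\<in>Q. poly N x > 0)"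
proof -
  have *: "\<exists>N. degree N \<le> k \<and> (\<forall>x\<in>P. poly N x > 0) \<and> (\<forall>x\<in>Q. poly N x < 0)"
    if PQ: "compact P" "compact Q" "P \<inter> Q = {}" and nc: "\<And>x. \<not> alt_chain (Suc k) P Q x"
      and p: "p \<in> P" "\<And>x. x \<in> Q \<Longrightarrow> x \<le> p" for P Q :: "real set" and p
  proof -
    have "\<not> alt_chain k Q P x" for x
    proof
      assume *: "alt_chain k Q P x"
      hence "x \<le> p" "x \<noteq> p" using p PQ(3) alt_chain_end[OF *] by auto
      thus False using nc[of p] * p(1) by auto
    qed
    hence "\<exists>N. degree N \<le> k \<and> (\<forall>x\<in>Q. poly N x < 0) \<and> (\<forall>x\<in>P. poly N x > 0)"
      using PQ by (intro ex_separating_poly)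
        (auto intro: compact_imp_closed bounded_imp_bdd_above compact_imp_bounded)
    thus ?thesis by blast
  qed
  show ?thesis
  proof (cases "P \<union> Q = {}")
    case True
    thus ?thesis by (intro exI[of _ 0]) auto
  next
    case False
    obtain p where p: "p \<in> P \<union> Q" "\<And>x. x \<in> P \<union> Q \<Longrightarrow> x \<le> p"
      using compact_attains_sup[OF compact_Un[OF assms(1,2)] False] by blast
    show ?thesis
    proof (cases "p \<in> Q")
      case True
      have "\<exists>N. degree N \<le> k \<and> (\<forall>x\<in>Q. poly N x > 0) \<and> (\<forall>x\<in>P. poly N x < 0)"
        using assms(1-3) p True by (intro *[OF _ _ _ assms(5)]) auto
      thus ?thesis by blast
    next
      case False
      hence "\<exists>N. degree N \<le> k \<and> (\<forall>x\<in>P. poly N x > 0) \<and> (\<forall>x\<in>Q. poly N x < 0)"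
        using assms(1-3) p by (intro *[OF _ _ _ assms(4)]) auto
      then obtain N where "degree N \<le> k" "\<forall>x\<in>P. poly N x > 0" "\<forall>x\<in>Q. poly N x < 0"
        by blast
      thus ?thesis by (intro exI[of _ "- N"]) auto
    qed
  qed
qed

lemma alt_chain_imp_sequence:
  assumes "alt_chain k P Q x"
  shows "\<exists>\<eta> :: nat \<Rightarrow> real. strict_mono_on {1..Suc k} \<eta> \<and> \<eta> (Suc k) = x \<and>
    (\<forall>j\<in>{1..Suc k}. \<eta> j \<in> (if even (Suc k + j) then P else Q))"
  using assms
proof (induction k arbitrary: P Q x)
  case 0
  thus ?case by (intro exI[of _ "\<lambda>_. x"]) (auto simp: strict_mono_on_def)
next
  case (Suc k)
  then obtain y where y: "y < x" "alt_chain k Q P y" "x \<in> P" by auto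
  obtain \<eta> where \<eta>: "strict_mono_on {1..Suc k} \<eta>" "\<eta> (Suc k) = y"
      "\<forall>j\<in>{1..Suc k}. \<eta> j \<in> (if even (Suc k + j) then Q else P)"
    using Suc.IH[OF y(2)] by blast
  let ?\<eta> = "\<eta>(Suc (Suc k) := x)"
  have le: "\<eta> j \<le> y" if "j \<in> {1..Suc k}" for j
    using strict_mono_onD[OF \<eta>(1) that, of "Suc k"] \<eta>(2) that by (cases "j = Suc k") auto
  have "strict_mono_on {1..Suc (Suc k)} ?\<eta>"
  proof (rule strict_mono_onI)
    fix i j assume ij: "i \<in> {1..Suc (Suc k)}" "j \<in> {1..Suc (Suc k)}" "i < j"
    show "?\<eta> i < ?\<eta> j"
    proof (cases "j = Suc (Suc k)")
      case True
      thus ?thesis using ij le[of i] y(1) by auto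
    next
      case False
      thus ?thesis using ij strict_mono_onD[OF \<eta>(1), of i j] by auto
    qed
  qed
  moreover have "?\<eta> j \<in> (if even (Suc (Suc k) + j) then P else Q)" if "j \<in> {1..Suc (Suc k)}" for j
  proof (cases "j = Suc (Suc k)")
    case False
    thus ?thesis using that bspec[OF \<eta>(3), of j] by (auto split: if_splits)
  qed (use y(3) in auto)
  moreover have "?\<eta> (Suc (Suc k)) = x" by simp
  ultimately show ?case by (intro exI[of _ ?\<eta>] conjI ballI)
qed

section \<open>Necessity of equioscillation\<close>

text \<open>
From a Bezout identity \<open>s a + t b = 1\<close> one gets \<open>N = a (s N) + b (t N)\<close>; reducing \<open>t N\<close> modulo
\<open>a\<close> bounds one cofactor by \<open>degree a\<close>, and comparing degrees bounds the other by \<open>n\<close>.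
\<close>

lemma ex_cross_difference_degree_le:
  fixes a b N :: "real poly"
  assumes "coprime a b" "a \<noteq> 0" "degree b \<le> degree a" "degree a \<le> n" "degree N \<le> n + degree a"
  shows "\<exists>u v. degree u \<le> n \<and> degree v \<le> n \<and> a * v - b * u = N"
proof -
  obtain s t where st: "s * a + t * b = 1"
    using assms(1) bezout_coefficients_fst_snd[of a b] by (metis coprime_iff_gcd_eq_1)
  define u where "u = (t * N) mod a"
  have deg_u: "degree u \<le> degree a" using degree_mod_less'[of a "t * N"] assms(2)
    unfolding u_def by (cases "(t * N) mod a = 0") auto
  have "N = s * a * N + t * b * N" by (metis st distrib_right mult_1)
  also have "t * b * N = b * ((t * N) div a * a + u)" 
    unfolding u_def div_mult_mod_eq by (simp add: algebra_simps)
  finally have "N - b * u = a * (s * N + b * ((t * N) div a))" by (simp add: algebra_simps)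
  then obtain v where v: "N - b * u = a * v" by blast
  have "degree (b * u) \<le> n + degree a"
    using degree_mult_le[of b u] deg_u assms(3,4) by linarith
  hence "degree (a * v) \<le> n + degree a"
    unfolding v[symmetric] using assms(5) by (intro degree_diff_le)
  hence "degree v \<le> n" using assms(2) by (cases "v = 0") (auto simp: degree_mult_eq)
  moreover have "degree (- u) \<le> n" using deg_u assms(4) by simp
  moreover have "a * v - b * (- u) = N" using v by (simp add: algebra_simps)
  ultimately show ?thesis by blast
qed

lemma ex_cross_difference:
  fixes a b N :: "real poly"
  assumes "coprime a b" "degree a \<le> n" "degree b \<le> n" "degree N \<le> n + max (degree a) (degree b)"
  shows "\<exists>u v. degree u \<le> n \<and> degree v \<le> n \<and> a * v - b * u = N"
proof (cases "a \<noteq> 0 \<and> degree b \<le> degree a")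
  case True
  thus ?thesis using assms ex_cross_difference_degree_le[of a b n N] by simp
next
  case False
  hence "b \<noteq> 0" "degree a \<le> degree b" using assms(1) by auto
  then obtain u v where "degree u \<le> n" "degree v \<le> n" "b * v - a * u = - N"
    using assms ex_cross_difference_degree_le[of b a n "- N"] by (auto simp: coprime_commute)
  thus ?thesis by (intro exI[of _ v] exI[of _ u]) (simp add: algebra_simps)
qed

text \<open>
With too few alternations there is \<open>N = a v - b u\<close> that is negative where \<open>S/C\<close> equals the
maximum \<open>K\<close> of \<open>\<bar>S/C\<bar>\<close> and positive where it equals \<open>-K\<close>. The condition \<open>\<bar>S/C\<bar> < K\<close> amounts to positivity
of \<open>K C - S\<close> and \<open>K C + S\<close>, both linear in \<open>(a, b)\<close> and nonnegative to begin with; at their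
zeros the direction \<open>(u, v)\<close> increases them, because the changes \<open>\<delta>C\<close>, \<open>\<delta>S\<close> in this direction
satisfy \<open>C \<cdot> (K \<delta>C - \<delta>S) = S \<delta>C - C \<delta>S = -N\<close> if \<open>S = K C\<close>, and \<open>C \<cdot> (K \<delta>C + \<delta>S) = N\<close> if
\<open>S = -K C\<close>.
\<close>

lemma best_imp_alt_chain:
  assumes best: "best_approx n \<omega> (urat a b)" and ab: "coprime a b" "degree a \<le> n" "degree b \<le> n"
    and hp: "half_plane \<omega> a b" and K: "max_norm (tan_err \<omega> a b) > 0"
  defines "E \<equiv> tan_err \<omega> a b" and "L \<equiv> n + max (degree a) (degree b)"
  defines "P \<equiv> {x \<in> {-1..1}. E x = max_norm E}" and "Q \<equiv> {x \<in> {-1..1}. E x = - max_norm E}"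
  shows "\<exists>x. alt_chain (Suc L) P Q x \<or> alt_chain (Suc L) Q P x"
proof (rule ccontr)
  assume no: "\<not> ?thesis"
  let ?K = "max_norm E"
  have cont: "continuous_on {-1..1} E" unfolding E_def by (rule continuous_on_tan_err[OF hp])
  have lev: "compact {x \<in> {-1..1}. E x = c}" for c
  proof -
    have "{x \<in> {-1..1}. E x = c} = {-1..1} \<inter> E -` {c}" by auto
    moreover have "closed ({-1..1} \<inter> E -` {c})"
      by (intro continuous_closed_preimage cont) auto
    ultimately show ?thesis using compact_Int_closed[of "{-1..1}" "{-1..1} \<inter> E -` {c}"]
      by (simp add: Int_left_absorb)
  qed
  have "compact P" "compact Q" "P \<inter> Q = {}"
    using lev K unfolding P_def Q_def E_def by auto
  then obtain N where N: "degree N \<le> L" "\<And>x. x \<in> P \<Longrightarrow> poly N x < 0" "\<And>x. x \<in> Q \<Longrightarrow> poly N x > 0"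
    using separating_poly_or_alt_chain[of P Q L] no by blast
  obtain u v where uv: "degree u \<le> n" "degree v \<le> n" "a * v - b * u = N"
    using ex_cross_difference[OF ab N(1)[unfolded L_def]] by blast
  let ?C = "rot_re \<omega> a b" and ?S = "rot_im \<omega> a b" and ?dC = "rot_re \<omega> u v" and ?dS = "rot_im \<omega> u v"
  have cross: "?C x * ?dS x - ?S x * ?dC x = poly N x" for x unfolding rot_cross uv(3) ..
  have C: "?C x > 0" if "x \<in> {-1..1}" for x by (rule half_planeD[OF hp that])
  have S: "?S x = E x * ?C x" if "x \<in> {-1..1}" for x
    using C[OF that] by (simp add: E_def tan_err_def)
  have bound: "\<bar>E x\<bar> \<le> ?K" if "x \<in> {-1..1}" for x using norm_le_max_norm[OF cont that] by simp
  have E1: "\<exists>\<epsilon>0>0. \<forall>\<epsilon>. 0 < \<epsilon> \<and> \<epsilon> \<le> \<epsilon>0 \<longrightarrow>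
      (\<forall>x\<in>{-1..1}. (?K * ?C x - ?S x) + \<epsilon> * (?K * ?dC x - ?dS x) > 0)"
  proof (rule positive_perturbation)
    fix x :: real assume x: "x \<in> {-1..1}"
    have eq: "?K * ?C x - ?S x = (?K - E x) * ?C x" using S[OF x] by (simp add: algebra_simps)
    show "?K * ?C x - ?S x \<ge> 0" unfolding eq using C[OF x] bound[OF x] by simp
    assume "?K * ?C x - ?S x = 0"
    hence *: "E x = ?K" unfolding eq using C[OF x] by simp
    hence "poly N x < 0" using N(2) x by (simp add: P_def)
    hence "?C x * (?K * ?dC x - ?dS x) > 0" using cross[of x] S[OF x] * by (simp add: algebra_simps)
    thus "?K * ?dC x - ?dS x > 0" using C[OF x] by (simp add: zero_less_mult_iff)
  qed (auto intro!: continuous_intros)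
  have E2: "\<exists>\<epsilon>0>0. \<forall>\<epsilon>. 0 < \<epsilon> \<and> \<epsilon> \<le> \<epsilon>0 \<longrightarrow>
      (\<forall>x\<in>{-1..1}. (?K * ?C x + ?S x) + \<epsilon> * (?K * ?dC x + ?dS x) > 0)"
  proof (rule positive_perturbation)
    fix x :: real assume x: "x \<in> {-1..1}"
    have eq: "?K * ?C x + ?S x = (?K + E x) * ?C x" using S[OF x] by (simp add: algebra_simps)
    show "?K * ?C x + ?S x \<ge> 0" unfolding eq using C[OF x] bound[OF x] by simp
    assume "?K * ?C x + ?S x = 0"
    hence *: "E x = - ?K" unfolding eq using C[OF x] by simp
    hence "poly N x > 0" using N(3) x by (simp add: Q_def)
    hence "?C x * (?K * ?dC x + ?dS x) > 0" using cross[of x] S[OF x] * by (simp add: algebra_simps)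
    thus "?K * ?dC x + ?dS x > 0" using C[OF x] by (simp add: zero_less_mult_iff)
  qed (auto intro!: continuous_intros)
  obtain \<epsilon>1 \<epsilon>2 where "\<epsilon>1 > 0" "\<epsilon>2 > 0" and
    e12: "\<And>\<epsilon> x. 0 < \<epsilon> \<Longrightarrow> \<epsilon> \<le> \<epsilon>1 \<Longrightarrow> x \<in> {-1..1} \<Longrightarrow> (?K * ?C x - ?S x) + \<epsilon> * (?K * ?dC x - ?dS x) > 0"
         "\<And>\<epsilon> x. 0 < \<epsilon> \<Longrightarrow> \<epsilon> \<le> \<epsilon>2 \<Longrightarrow> x \<in> {-1..1} \<Longrightarrow> (?K * ?C x + ?S x) + \<epsilon> * (?K * ?dC x + ?dS x) > 0"
    using E1 E2 by metis
  define \<epsilon> where "\<epsilon> = min \<epsilon>1 \<epsilon>2"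
  have \<epsilon>: "\<epsilon> > 0" "\<epsilon> \<le> \<epsilon>1" "\<epsilon> \<le> \<epsilon>2" using \<open>\<epsilon>1 > 0\<close> \<open>\<epsilon>2 > 0\<close> by (auto simp: \<epsilon>_def)
  define a' b' where "a' = a + smult \<epsilon> u" and "b' = b + smult \<epsilon> v"
  have C': "rot_re \<omega> a' b' x = ?C x + \<epsilon> * ?dC x" and S': "rot_im \<omega> a' b' x = ?S x + \<epsilon> * ?dS x" for x
    by (simp_all add: a'_def b'_def rot_add rot_smult)
  have less: "\<bar>rot_im \<omega> a' b' x\<bar> < ?K * rot_re \<omega> a' b' x" if "x \<in> {-1..1}" for x
    using e12(1)[OF \<epsilon>(1,2) that] e12(2)[OF \<epsilon>(1,3) that] unfolding C' S'
    by (simp add: algebra_simps abs_less_iff)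
  have hp': "half_plane \<omega> a' b'"
    unfolding half_plane_def
  proof
    fix x :: real assume x: "x \<in> {-1..1}"
    have "?K * rot_re \<omega> a' b' x > 0" using less[OF x] abs_ge_zero le_less_trans by blast
    thus "rot_re \<omega> a' b' x > 0" using K by (simp add: E_def zero_less_mult_iff)
  qed
  have deg': "degree a' \<le> n" "degree b' \<le> n"
    unfolding a'_def b'_def using ab uv by (auto intro!: degree_add_le degree_smult_le[THEN order_trans])
  have "max_norm (tan_err \<omega> a' b') < ?K"
    unfolding max_norm_less_iff[OF continuous_on_tan_err[OF hp']]
  proof
    fix x :: real assume x: "x \<in> {-1..1}"
    show "norm (tan_err \<omega> a' b' x) < ?K"
      using less[OF x] half_planeD[OF hp' x] by (simp add: tan_err_def pos_divide_less_eq)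
  qed
  hence "approx_err \<omega> (urat a' b') < approx_err \<omega> (urat a b)"
    using approx_err_le_iff[OF hp hp'] by (simp add: E_def not_le[symmetric])
  moreover have "urat a' b' \<in> unitary_rat n"
    by (rule urat_in_unitary_rat[OF deg' half_plane_nonzero[OF hp']])
  ultimately show False using best unfolding best_approx_def by (meson not_le)
qed

lemma equioscillates_imp_card:
  assumes "equioscillates_at e m \<eta>" "continuous_on {-1..1} e" "finite (extremal_points e)"
  shows "m \<le> card (extremal_points e)"
proof -
  have "\<eta> j \<in> extremal_points e" if "j \<in> {1..m}" for j
  proof -
    have "\<eta> j \<in> equioscillation_points e" using assms(1) that unfolding equioscillation_points_def by blast
    thus ?thesis using equioscillation_points_eq[OF assms(2)] by simp
  qed
  hence "\<eta> ` {1..m} \<subseteq> extremal_points e" by blast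
  hence "card (\<eta> ` {1..m}) \<le> card (extremal_points e)" by (rule card_mono[OF assms(3)])
  moreover have "inj_on \<eta> {1..m}"
    using assms(1) strict_mono_on_imp_inj_on unfolding equioscillates_at_def by blast
  ultimately show ?thesis by (simp add: card_image)
qed

text \<open>
All claims follow from one chain of inequalities. With \<open>m\<close> the larger degree, \<open>k\<close> the number of
distinct poles and \<open>Z\<close> the zeros of the derivative,
\<open>n + m + 2 \<le> card (extremal_points e) \<le> card Z + 2 \<le> 2k + 2 \<le> 2m + 2 \<le> n + m + 2\<close>, so equality
holds everywhere.
\<close>

lemma best_approx_structure:
  assumes best: "best_approx n \<omega> r" and r: "r = urat a b" and ab: "coprime a b" "degree a \<le> n"
      "degree b \<le> n"
    and hp: "half_plane \<omega> a b" and \<omega>: "\<omega> > 0" and pf: "phase_function \<omega> r g"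
  defines "e \<equiv> phase_error \<omega> g"
  shows "max (degree a) (degree b) = n" "card (set_mset (poles r)) = n" "equioscillates e (2 * n + 2)"
    "card (extremal_points e) = 2 * n + 2" "-1 \<in> extremal_points e" "1 \<in> extremal_points e"
    "extremal_points e \<inter> {-1<..<1} = {x. deriv e x = 0}"
    "\<And>x. deriv e x = 0 \<Longrightarrow> deriv (deriv e) x \<noteq> 0"
proof -
  let ?E = "tan_err \<omega> a b"
  let ?m = "max (degree a) (degree b)"
  let ?k = "card (set_mset (poles r))"
  have rn: "r \<in> unitary_rat n" using best by (simp add: best_approx_def)
  have cont: "continuous_on {-1..1} e" unfolding e_def by (rule continuous_on_phase_error[OF rn pf])
  have e_eq: "e x = - 2 * arctan (?E x)" if "x \<in> {-1..1}" for x
    using phase_error_eq_arctan[OF hp _ _ that] rn pf unfolding e_def r by blast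
  have max_e: "max_norm e = 2 * arctan (max_norm ?E)"
    using max_norm_phase_error[OF hp] rn pf unfolding e_def r by blast
  obtain N D :: "real poly" where ND: "N \<noteq> 0" "degree N \<le> 2 * ?k" "\<And>x. poly D x > 0"
    "\<And>x. (e has_real_derivative poly N x / poly D x) (at x)"
    unfolding e_def using phase_function_derivE[OF r ab(1) \<omega> pf] by blast
  have deriv_e: "deriv e = (\<lambda>x. poly N x / poly D x)"
    using ND(4) by (auto intro: DERIV_imp_deriv)
  let ?Z = "{x. poly N x = 0}" and ?X = "extremal_points e"
  have Z: "{x. deriv e x = 0} = ?Z" unfolding deriv_e using ND(3) by (auto simp: less_le)
  have finZ: "finite ?Z" by (rule poly_roots_finite[OF ND(1)])
  have cardZ: "card ?Z \<le> 2 * ?k" using card_poly_roots_bound[OF ND(1)] ND(2) by linarith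
  have XZ: "?X \<inter> {-1<..<1} \<subseteq> ?Z"
    using interior_extremal_deriv[OF cont _ _ ND(4)] ND(3) by (auto simp: less_le)
  have X_split: "?X \<subseteq> (?X \<inter> {-1<..<1}) \<union> {-1, 1}" by (force simp: extremal_points_def)
  have finX: "finite ?X" using X_split XZ finZ
      by (meson finite.emptyI finite_Un finite_insert finite_subset)
  have cardX: "card ?X \<le> card (?X \<inter> {-1<..<1}) + card (?X \<inter> {-1, 1})"
  proof -
    have "?X = (?X \<inter> {-1<..<1}) \<union> (?X \<inter> {-1, 1})" using X_split by blast
    thus ?thesis using card_Un_le by metis
  qed
  \<comment> \<open>If the phase error vanished on \<open>[-1,1]\<close>, every point there would be extremal.\<close>
  have K: "max_norm ?E > 0"
  proof (rule ccontr)
    assume "\<not> max_norm ?E > 0"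
    hence "max_norm ?E = 0" using max_norm_nonneg[OF continuous_on_tan_err[OF hp]] by linarith
    hence "max_norm e = 0" using max_e by simp
    hence "?X = {-1..1}" using norm_le_max_norm[OF cont] by (force simp: extremal_points_def)
    thus False using finX by (simp add: infinite_Icc)
  qed
  define P Q where "P = {x \<in> {-1..1}. ?E x = max_norm ?E}" and "Q = {x \<in> {-1..1}. ?E x = - max_norm ?E}"
  have eP: "e x = - max_norm e" if "x \<in> P" for x
    using that e_eq[of x] max_e by (simp add: P_def)
  have eQ: "e x = max_norm e" if "x \<in> Q" for x
    using that e_eq[of x] max_e by (simp add: Q_def arctan_minus)
  let ?m2 = "n + ?m + 2"
  have "\<exists>\<eta>. equioscillates_at e ?m2 \<eta>"
  proof -
    have seq: "\<exists>\<eta>. equioscillates_at e ?m2 \<eta>"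
      \<comment> \<open>\<open>k\<close> encodes the sign of \<open>e\<close> on the set in which the chain ends.\<close>
      if chain: "alt_chain (Suc (n + ?m)) A B x" and AB: "A \<subseteq> {-1..1}" "B \<subseteq> {-1..1}"
        and sg: "\<And>x. x \<in> A \<Longrightarrow> e x = (-1) ^ k * max_norm e" "\<And>x. x \<in> B \<Longrightarrow> e x = (-1) ^ Suc k * max_norm e"
      for A B x and k :: nat
    proof -
      have m2: "Suc (Suc (n + ?m)) = ?m2" by simp
      obtain \<eta> where \<eta>: "strict_mono_on {1..?m2} \<eta>"
          "\<And>j. j \<in> {1..?m2} \<Longrightarrow> \<eta> j \<in> (if even (?m2 + j) then A else B)"
        using alt_chain_imp_sequence[OF chain] unfolding m2 by blast
      have "\<eta> j \<in> {-1..1}" if "j \<in> {1..?m2}" for j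
        using \<eta>(2)[OF that] AB by (metis subsetD)
      moreover define \<iota> :: nat where "\<iota> = (if even (?m2 + k) then 0 else 1)"
      have "e (\<eta> j) = (-1) ^ (j + \<iota>) * max_norm e" if "j \<in> {1..?m2}" for j
      proof (cases "even (?m2 + j)")
        case True
        hence "e (\<eta> j) = (-1) ^ k * max_norm e" using \<eta>(2)[OF that] sg(1) by simp
        moreover have "even k \<longleftrightarrow> even (j + \<iota>)" using True by (simp add: \<iota>_def)
        ultimately show ?thesis by (simp only: minus_one_power_iff)
      next
        case False
        hence "e (\<eta> j) = (-1) ^ Suc k * max_norm e" using \<eta>(2)[OF that] sg(2) by simp
        moreover have "even (Suc k) \<longleftrightarrow> even (j + \<iota>)" using False by (simp add: \<iota>_def)
        ultimately show ?thesis by (simp only: minus_one_power_iff)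
      qed
      moreover have "\<iota> \<in> {0, 1}" by (simp add: \<iota>_def)
      ultimately show ?thesis using \<eta>(1) unfolding equioscillates_at_def by blast
    qed
    obtain x where "alt_chain (Suc (n + ?m)) P Q x \<or> alt_chain (Suc (n + ?m)) Q P x"
      using best_imp_alt_chain[OF best[unfolded r] ab hp K] unfolding P_def Q_def by blast
    moreover have "P \<subseteq> {-1..1}" "Q \<subseteq> {-1..1}" by (auto simp: P_def Q_def)
    ultimately show ?thesis
      using seq[of P Q x 1] seq[of Q P x 0] eP eQ by auto
  qed
  then obtain \<eta> where \<eta>: "equioscillates_at e ?m2 \<eta>" by blast
  have m2: "?m2 \<le> card ?X" by (rule equioscillates_imp_card[OF \<eta> cont finX])
  have "size (poles r) = ?m" unfolding r by (rule size_poles_urat[OF ab(1)])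
  hence k_le: "?k \<le> ?m" using size_multiset_overloaded_eq[of "poles r"]
      sum_mono[of "set_mset (poles r)" "\<lambda>_. 1" "count (poles r)"] by (simp add: Suc_le_eq)
  have c1: "card (?X \<inter> {-1<..<1}) \<le> card ?Z" by (rule card_mono[OF finZ XZ])
  have c2: "card (?X \<inter> {-1, 1}) \<le> 2"
    using card_mono[of "{-1, 1::real}" "?X \<inter> {-1, 1}"] by simp
  have mn: "?m \<le> n" using ab by simp
  have m: "?m = n" and k: "?k = n" and cX: "card ?X = 2 * n + 2" and cZ: "card ?Z = 2 * n"
    and cXi: "card (?X \<inter> {-1<..<1}) = 2 * n" and cXb: "card (?X \<inter> {-1, 1}) = 2"
    using m2 k_le c1 c2 cardX cardZ mn by linarith+
  show "?m = n" "?k = n" "card ?X = 2 * n + 2" by (fact m, fact k, fact cX)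
  show "equioscillates e (2 * n + 2)" using \<eta> m unfolding equioscillates_def by (auto simp: mult_2)
  have "?X \<inter> {-1, 1} = {-1, 1}"
    by (rule card_subset_eq) (use cXb in auto)
  thus "-1 \<in> ?X" "1 \<in> ?X" by auto
  show "?X \<inter> {-1<..<1} = {x. deriv e x = 0}"
    unfolding Z by (rule card_subset_eq[OF finZ XZ]) (simp add: cXi cZ)
  show "deriv (deriv e) x \<noteq> 0" if "deriv e x = 0" for x
  proof
    assume d2: "deriv (deriv e) x = 0"
    have x: "poly N x = 0" using that Z by blast
    have "(deriv e has_real_derivative (poly (pderiv N) x * poly D x -
        poly N x * poly (pderiv D) x) / (poly D x * poly D x)) (at x)"
      unfolding deriv_e using ND(3)[of x]
      by (auto intro!: DERIV_divide poly_DERIV)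
    hence "poly (pderiv N) x = 0" using d2 x ND(3)[of x] by (auto dest: DERIV_imp_deriv)
    \<comment> \<open>A double zero \<open>x\<close> leaves a quotient of degree below \<open>2n\<close> that still vanishes at all \<open>2n\<close> zeros.\<close>
    obtain M where M: "N = [:-x, 1:] * M" using x by (auto simp: poly_eq_0_iff_dvd dvd_def)
    have "M \<noteq> 0" using M ND(1) by auto
    have "degree N = Suc (degree M)" unfolding M using \<open>M \<noteq> 0\<close> by (subst degree_mult_eq) auto
    hence "degree M < 2 * n" using ND(2) k by simp
    moreover have "poly M x = 0"
      using \<open>poly (pderiv N) x = 0\<close> unfolding M pderiv_mult by (simp add: pderiv_pCons)
    hence "?Z \<subseteq> {y. poly M y = 0}" unfolding M by auto
    hence "2 * n \<le> card {y. poly M y = 0}"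
      using card_mono[OF poly_roots_finite[OF \<open>M \<noteq> 0\<close>]] cZ by metis
    ultimately show False using card_poly_roots_bound[OF \<open>M \<noteq> 0\<close>] by linarith
  qed
qed

section \<open>Uniqueness\<close>

text \<open>
The sum of two optimal pairs satisfies the same constraint \<open>\<bar>S\<bar> \<le> K C\<close> and is optimal as well.
At an extremal point of the sum the constraint is an equality of one sign, hence it is for both
summands.
\<close>

lemma best_approx_unique:
  assumes \<omega>: "0 < \<omega>" "\<omega> < (real n + 1) * pi" and best: "best_approx n \<omega> r" "best_approx n \<omega> u"
  shows "u = r"
proof -
  have mem: "r \<in> unitary_rat n" "u \<in> unitary_rat n" using best by (simp_all add: best_approx_def)
  obtain a b where r: "r = urat a b" "coprime a b" "degree a \<le> n" "degree b \<le> n" "half_plane \<omega> a b"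
    using ex_half_plane_rep[OF mem(1) best_approx_err_less_2[OF \<omega> best(1)]] by blast
  obtain c d where u: "u = urat c d" "coprime c d" "degree c \<le> n" "degree d \<le> n" "half_plane \<omega> c d"
    using ex_half_plane_rep[OF mem(2) best_approx_err_less_2[OF \<omega> best(2)]] by blast
  define K where "K = max_norm (tan_err \<omega> a b)"
  have "approx_err \<omega> r = approx_err \<omega> u" using best mem unfolding best_approx_def by (meson antisym)
  hence K': "max_norm (tan_err \<omega> c d) = K"
    using approx_err_le_iff[OF r(5) u(5)] approx_err_le_iff[OF u(5) r(5)] unfolding r(1) u(1) K_def by simp
  have bd: "\<bar>rot_im \<omega> a b x\<bar> \<le> K * rot_re \<omega> a b x" "\<bar>rot_im \<omega> c d x\<bar> \<le> K * rot_re \<omega> c d x"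
    if x: "x \<in> {-1..1}" for x
    using norm_le_max_norm[OF continuous_on_tan_err[OF r(5)] x] norm_le_max_norm[OF continuous_on_tan_err[OF u(5)] x]
      half_planeD[OF r(5) x] half_planeD[OF u(5) x]
    unfolding K' K_def[symmetric] tan_err_def by (simp_all add: pos_divide_le_eq)
  have hp: "half_plane \<omega> (a + c) (b + d)"
    using r(5) u(5) unfolding half_plane_def rot_add by (auto intro: add_pos_pos)
  have deg: "degree (a + c) \<le> n" "degree (b + d) \<le> n" using r u by (auto intro: degree_add_le)
  have le: "max_norm (tan_err \<omega> (a + c) (b + d)) \<le> K"
  proof -
    obtain x where x: "x \<in> {-1..1}" "\<bar>tan_err \<omega> (a + c) (b + d) x\<bar> = max_norm (tan_err \<omega> (a + c) (b + d))"
      using max_norm_attained[OF continuous_on_tan_err[OF hp]] by auto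
    have "\<bar>tan_err \<omega> (a + c) (b + d) x\<bar> \<le> K"
      using bd[OF x(1)] half_planeD[OF hp x(1)] unfolding tan_err_def rot_add
      by (simp add: pos_divide_le_eq algebra_simps)
    thus ?thesis using x by simp
  qed
  let ?t = "urat (a + c) (b + d)"
  have tm: "?t \<in> unitary_rat n" by (rule urat_in_unitary_rat[OF deg half_plane_nonzero[OF hp]])
  have "approx_err \<omega> ?t \<le> approx_err \<omega> r"
    unfolding r(1) using approx_err_le_iff[OF hp r(5)] le by (simp add: K_def)
  hence tbest: "best_approx n \<omega> ?t" and teq: "approx_err \<omega> ?t = approx_err \<omega> r"
    using best(1) tm unfolding best_approx_def by (auto intro: order_trans antisym)
  have tK: "max_norm (tan_err \<omega> (a + c) (b + d)) = K"
    using teq approx_err_le_iff[OF hp r(5)] approx_err_le_iff[OF r(5) hp] unfolding r(1) K_def by simp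
  \<comment> \<open>\<open>a + c\<close> and \<open>b + d\<close> need not be coprime, so the structure of the sum is read off a reduced pair.\<close>
  have t2: "approx_err \<omega> ?t < 2" by (rule approx_err_half_plane_less_2[OF hp])
  obtain g where g: "phase_function \<omega> ?t g" using ex_phase_function[OF tm t2] by blast
  obtain a' b' where t: "?t = urat a' b'" "coprime a' b'" "degree a' \<le> n" "degree b' \<le> n"
      "half_plane \<omega> a' b'"
    using ex_half_plane_rep[OF tm t2] by blast
  let ?X = "extremal_points (phase_error \<omega> g)"
  have cX: "card ?X = 2 * n + 2"
    by (rule best_approx_structure(4)[OF tbest t \<omega>(1) g])
  define N where "N = a * d - b * c"
  have "poly N x = 0" if x: "x \<in> ?X" for x
  proof -
    have xi: "x \<in> {-1..1}" using x by (simp add: extremal_points_def)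
    have "\<bar>phase_error \<omega> g x\<bar> = 2 * arctan K"
      using x max_norm_phase_error[OF hp tm g] tK by (simp add: extremal_points_def)
    moreover have "\<bar>phase_error \<omega> g x\<bar> = 2 * arctan \<bar>tan_err \<omega> (a + c) (b + d) x\<bar>"
      unfolding phase_error_eq_arctan[OF hp tm g xi] by (simp add: abs_mult abs_if arctan_minus)
    ultimately have "arctan \<bar>tan_err \<omega> (a + c) (b + d) x\<bar> = arctan K" by simp
    hence "\<bar>tan_err \<omega> (a + c) (b + d) x\<bar> = K" by (simp add: arctan_eq_iff)
    hence eq: "\<bar>rot_im \<omega> a b x + rot_im \<omega> c d x\<bar> = K * (rot_re \<omega> a b x + rot_re \<omega> c d x)"
      using half_planeD[OF hp xi] unfolding tan_err_def rot_add by (auto simp: field_simps)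
    have "rot_im \<omega> a b x = K * rot_re \<omega> a b x \<and> rot_im \<omega> c d x = K * rot_re \<omega> c d x \<or>
          rot_im \<omega> a b x = - (K * rot_re \<omega> a b x) \<and> rot_im \<omega> c d x = - (K * rot_re \<omega> c d x)"
      using eq bd[OF xi] unfolding distrib_left by linarith
    hence "rot_re \<omega> a b x * rot_im \<omega> c d x - rot_im \<omega> a b x * rot_re \<omega> c d x = 0" by auto
    thus ?thesis unfolding rot_cross N_def .
  qed
  hence X: "?X \<subseteq> {x. poly N x = 0}" by blast
  have "N = 0"
  proof (rule ccontr)
    assume "N \<noteq> 0"
    have "degree N \<le> 2 * n"
      unfolding N_def using r u degree_mult_le[of a d] degree_mult_le[of b c]
      by (intro degree_diff_le) linarith+
    moreover have "2 * n + 2 \<le> card {x. poly N x = 0}"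
      using card_mono[OF poly_roots_finite[OF \<open>N \<noteq> 0\<close>] X] cX by simp
    ultimately show False using card_poly_roots_bound[OF \<open>N \<noteq> 0\<close>] by linarith
  qed
  hence "urat a b = urat c d" using urat_eq_iff[OF r(2) u(2)] by (simp add: N_def)
  thus ?thesis using r u by simp
qed

section \<open>Sufficiency of equioscillation\<close>

text \<open>
If the amplitude is at least \<open>\<pi>\<close>, which is possible only for error \<open>2\<close>, the bound holds because
the better approximant has a phase error below \<open>\<pi>\<close>. Otherwise half of both phase errors lies
where sine is increasing.
\<close>

lemma smaller_phase_error:
  assumes r: "r \<in> unitary_rat n" "phase_function \<omega> r g" and u: "u \<in> unitary_rat n" "phase_function \<omega> u h"
    and less: "approx_err \<omega> u < approx_err \<omega> r" and x: "x \<in> {-1..1}"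
  shows "\<bar>phase_error \<omega> h x\<bar> < max_norm (phase_error \<omega> g)"
proof -
  let ?A = "max_norm (phase_error \<omega> g)" and ?e = "phase_error \<omega> g" and ?f = "phase_error \<omega> h"
  have "approx_err \<omega> u < 2" using less approx_err_le_2[OF r(1), of \<omega>] by linarith
  hence "max_norm ?f < pi" using u(2) unfolding phase_function_def by blast
  hence fpi: "\<bar>?f x\<bar> < pi" using norm_le_max_norm[OF continuous_on_phase_error[OF u] x] by simp
  show ?thesis
  proof (cases "?A < pi")
    case True
    obtain z where z: "z \<in> {-1..1}"
        "norm (rat_eval r (\<i> * of_real z) - exp (of_real \<omega> * (\<i> * of_real z))) = approx_err \<omega> r"
      unfolding approx_err_def using max_norm_attained[OF continuous_on_err[OF r(1)]] by blast
    have "2 * \<bar>sin (?f x / 2)\<bar> \<le> approx_err \<omega> u"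
      using norm_le_max_norm[OF continuous_on_err[OF u(1)] x, of \<omega>]
          unfolding norm_err_phase[OF u(2)] approx_err_def .
    also note less
    also have "approx_err \<omega> r = 2 * \<bar>sin (?e z / 2)\<bar>" using z(2) unfolding norm_err_phase[OF r(2)] by simp
    finally have lt: "\<bar>sin (?f x / 2)\<bar> < \<bar>sin (?e z / 2)\<bar>" by simp
    have ez: "\<bar>?e z\<bar> \<le> ?A" using norm_le_max_norm[OF continuous_on_phase_error[OF r] z(1)] by simp
    have abs_sin: "\<bar>sin (y / 2)\<bar> = sin (\<bar>y\<bar> / 2)" if "\<bar>y\<bar> < pi" for y :: real
      using that sin_gt_zero[of "\<bar>y\<bar> / 2"] by (cases "y = 0") (auto simp: abs_if split: if_splits)
    have "sin (\<bar>?f x\<bar> / 2) < sin (\<bar>?e z\<bar> / 2)"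
      using lt abs_sin[OF fpi] abs_sin[of "?e z"] ez True by simp
    hence "\<bar>?f x\<bar> / 2 < \<bar>?e z\<bar> / 2"
      using fpi ez True by (subst (asm) sin_mono_less_eq) auto
    thus ?thesis using ez by simp
  next
    case False
    thus ?thesis using fpi by simp
  qed
qed

text \<open>
The zeros of the difference of the two phases are located by the intermediate value theorem,
strictly between consecutive equioscillation points.
\<close>

lemma equioscillation_imp_best:
  assumes r: "r \<in> unitary_rat n" "phase_function \<omega> r g" and eq:
      "equioscillates (phase_error \<omega> g) (2 * n + 2)"
  shows "best_approx n \<omega> r"
proof (rule ccontr)
  assume "\<not> best_approx n \<omega> r"
  then obtain u where u: "u \<in> unitary_rat n" "approx_err \<omega> u < approx_err \<omega> r"
    using r(1) unfolding best_approx_def by (auto simp: not_le)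
  have "approx_err \<omega> u < 2" using u(2) approx_err_le_2[OF r(1), of \<omega>] by linarith
  then obtain h where h: "phase_function \<omega> u h" using ex_phase_function[OF u(1)] by blast
  let ?A = "max_norm (phase_error \<omega> g)"
  define d where "d x = phase_error \<omega> g x - phase_error \<omega> h x" for x
  have cont: "continuous_on S d" for S
    unfolding d_def
        by (intro continuous_intros continuous_on_phase_error[OF r] continuous_on_phase_error[OF u(1) h])
  obtain \<eta> \<iota> where \<eta>: "\<eta> ` {1..2 * n + 2} \<subseteq> {-1..1}" "strict_mono_on {1..2 * n + 2} \<eta>"
      "\<And>j. j \<in> {1..2 * n + 2} \<Longrightarrow> phase_error \<omega> g (\<eta> j) = (-1) ^ (j + \<iota>) * ?A"
    using eq unfolding equioscillates_def equioscillates_at_def by blast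
  have sgn: "(-1) ^ (j + \<iota>) * d (\<eta> j) > 0" if "j \<in> {1..2 * n + 2}" for j
  proof -
    have "\<eta> j \<in> {-1..1}" using \<eta>(1) that by blast
    from smaller_phase_error[OF r u(1) h u(2) this] show ?thesis
      unfolding d_def \<eta>(3)[OF that] by (cases "even (j + \<iota>)") (auto simp: abs_less_iff)
  qed
  have "\<exists>z. \<eta> j < z \<and> z < \<eta> (Suc j) \<and> d z = 0" if j: "j \<in> {1..2 * n + 1}" for j
  proof -
    have s: "(-1) ^ (j + \<iota>) * d (\<eta> j) > 0" "(-1) ^ (j + \<iota>) * d (\<eta> (Suc j)) < 0"
      using sgn[of j] sgn[of "Suc j"] j by auto
    have lt: "\<eta> j < \<eta> (Suc j)" using j by (intro strict_mono_onD[OF \<eta>(2)]) auto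
    have "\<exists>z. \<eta> j \<le> z \<and> z \<le> \<eta> (Suc j) \<and> (-1) ^ (j + \<iota>) * d z = 0"
      using s lt by (intro IVT2' continuous_intros cont) auto
    then obtain z where z: "\<eta> j \<le> z" "z \<le> \<eta> (Suc j)" "d z = 0" by auto
    moreover have "z \<noteq> \<eta> j" "z \<noteq> \<eta> (Suc j)" using s z(3) by auto
    ultimately show ?thesis by force
  qed
  then obtain z where z: "\<And>j. j \<in> {1..2 * n + 1} \<Longrightarrow> \<eta> j < z j \<and> z j < \<eta> (Suc j) \<and> d (z j) = 0"
    by metis
  have "z i < z j" if "i \<in> {1..2 * n + 1}" "j \<in> {1..2 * n + 1}" "i < j" for i j
  proof -
    have "\<eta> (Suc i) \<le> \<eta> j"
      using that strict_mono_onD[OF \<eta>(2), of "Suc i" j] by (cases "Suc i = j") auto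
    thus ?thesis using z[OF that(1)] z[OF that(2)] by linarith
  qed
  hence "strict_mono_on {1..2 * n + 1} z" by (intro strict_mono_onI)
  hence inj: "inj_on z {1..2 * n + 1}" by (rule strict_mono_on_imp_inj_on)
  obtain a b where ab: "r = urat a b" "coprime a b" "degree a \<le> n" "degree b \<le> n"
    using r(1) by (rule unitary_rat_cases)
  obtain c e where ce: "u = urat c e" "coprime c e" "degree c \<le> n" "degree e \<le> n"
    using u(1) by (rule unitary_rat_cases)
  define N where "N = a * e - b * c"
  have zero: "poly N x = 0" if "d x = 0" for x
  proof -
    let ?p = "Complex (poly a x) (poly b x)" and ?q = "Complex (poly c x) (poly e x)"
    have "g x = h x" using that by (simp add: d_def phase_error_def)
    hence "rat_eval r (\<i> * of_real x) = rat_eval u (\<i> * of_real x)"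
      using r(2) h unfolding phase_function_def by simp
    hence "cnj ?p / ?p = cnj ?q / ?q"
      unfolding ab(1) ce(1) using coprime_no_common_root[OF ab(2)] coprime_no_common_root[OF ce(2)]
      by (simp add: rat_eval_urat)
    moreover have "?p \<noteq> 0" "?q \<noteq> 0"
      using coprime_no_common_root[OF ab(2), of x] coprime_no_common_root[OF ce(2), of x]
      by (auto simp: complex_eq_iff)
    ultimately have "cnj ?p * ?q = cnj ?q * ?p" by (simp only: divide_eq_eq) (simp add: frac_eq_eq)
    hence "Im (cnj ?p * ?q) = Im (cnj ?q * ?p)" by simp
    thus ?thesis by (simp add: N_def algebra_simps)
  qed
  have "N = 0"
  proof (rule ccontr)
    assume "N \<noteq> 0"
    have "degree N \<le> 2 * n"
      unfolding N_def using ab ce degree_mult_le[of a e] degree_mult_le[of b c]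
      by (intro degree_diff_le) linarith+
    moreover have "z ` {1..2 * n + 1} \<subseteq> {x. poly N x = 0}" using z zero by blast
    hence "card (z ` {1..2 * n + 1}) \<le> card {x. poly N x = 0}"
      by (rule card_mono[OF poly_roots_finite[OF \<open>N \<noteq> 0\<close>]])
    hence "2 * n + 1 \<le> card {x. poly N x = 0}" using card_image[OF inj] by simp
    ultimately show False using card_poly_roots_bound[OF \<open>N \<noteq> 0\<close>] by linarith
  qed
  hence "r = u" using urat_eq_iff[OF ab(2) ce(2)] ab ce by (simp add: N_def)
  thus False using u(2) by simp
qed

section \<open>Characterisation of the unitary best approximation\<close>

theorem theorem5p1:
  fixes n :: nat and \<omega> :: real and r :: "complex poly fract"
  assumes "n \<ge> 1" and "0 < \<omega>" and "\<omega> < (real n + 1) * pi"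
    and "r \<in> unitary_rat n"
  shows "(best_approx n \<omega> r \<longleftrightarrow>
            (\<exists>g. phase_function \<omega> r g \<and> equioscillates (phase_error \<omega> g) (2 * n + 2))) \<and>
         (best_approx n \<omega> r \<longrightarrow>
            approx_err \<omega> r < 2 \<and>
            (\<forall>u. best_approx n \<omega> u \<longrightarrow> u = r) \<and>
            min_degree r = n \<and> (\<forall>s. count (poles r) s \<le> 1) \<and>
            (\<forall>g. phase_function \<omega> r g \<longrightarrow>
               card (equioscillation_points (phase_error \<omega> g)) = 2 * n + 2 \<and>
               -1 \<in> equioscillation_points (phase_error \<omega> g) \<and>
               1 \<in> equioscillation_points (phase_error \<omega> g) \<and>
               equioscillation_points (phase_error \<omega> g) \<inter> {-1<..<1} =
                 {x. deriv (phase_error \<omega> g) x = 0} \<and>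
               (\<forall>x. deriv (phase_error \<omega> g) x = 0 \<longrightarrow>
                  deriv (deriv (phase_error \<omega> g)) x \<noteq> 0)))"
proof (cases "best_approx n \<omega> r")
  case False
  thus ?thesis using equioscillation_imp_best[OF assms(4)] by blast
next
  case best: True
  have lt2: "approx_err \<omega> r < 2" by (rule best_approx_err_less_2[OF assms(2,3) best])
  obtain a b where ab: "r = urat a b" "coprime a b" "degree a \<le> n" "degree b \<le> n" "half_plane \<omega> a b"
    using ex_half_plane_rep[OF assms(4) lt2] by blast
  note struct = best_approx_structure[OF best ab assms(2)]
  obtain g where g: "phase_function \<omega> r g" using ex_phase_function[OF assms(4) lt2] by blast
  have osc: "\<exists>g. phase_function \<omega> r g \<and> equioscillates (phase_error \<omega> g) (2 * n + 2)"
    using g struct(3)[OF g] by blast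
  have deg: "min_degree r = n" unfolding ab(1) min_degree_urat[OF ab(2)] by (rule struct(1)[OF g])
  have "count (poles r) s \<le> 1" for s
  proof (rule ccontr)
    assume s: "\<not> count (poles r) s \<le> 1"
    have "size (poles r) = n" unfolding ab(1) size_poles_urat[OF ab(2)] by (rule struct(1)[OF g])
    moreover have "size (poles r) > card (set_mset (poles r))"
    proof -
      have "(\<Sum>t\<in>set_mset (poles r). 1) < (\<Sum>t\<in>set_mset (poles r). count (poles r) t)"
      proof (rule sum_strict_mono_ex1)
        show "\<forall>t\<in>set_mset (poles r). 1 \<le> count (poles r) t" by (simp add: Suc_le_eq)
        have "s \<in># poles r" using s by (metis count_eq_zero_iff zero_le)
        thus "\<exists>t\<in>set_mset (poles r). 1 < count (poles r) t" using s by (intro bexI[of _ s]) auto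
      qed simp
      thus ?thesis by (simp add: size_multiset_overloaded_eq)
    qed
    ultimately show False using struct(2)[OF g] by simp
  qed
  moreover have "card (equioscillation_points (phase_error \<omega> h)) = 2 * n + 2 \<and>
               -1 \<in> equioscillation_points (phase_error \<omega> h) \<and>
               1 \<in> equioscillation_points (phase_error \<omega> h) \<and>
               equioscillation_points (phase_error \<omega> h) \<inter> {-1<..<1} =
                 {x. deriv (phase_error \<omega> h) x = 0} \<and>
               (\<forall>x. deriv (phase_error \<omega> h) x = 0 \<longrightarrow>
                  deriv (deriv (phase_error \<omega> h)) x \<noteq> 0)" if h: "phase_function \<omega> r h" for h
    using struct(4-8)[OF h] equioscillation_points_eq[OF continuous_on_phase_error[OF assms(4) h]]
    by simp
  ultimately show ?thesis
    using best osc lt2 deg best_approx_unique[OF assms(2,3) best] by blast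
qed

end
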